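(* Let $\mathcal{B}\subset\mathcal{A}$ be an irreducible inclusion of unital $C^*$-algebras (with common unit) with a finite-index conditional expectation $E:\mathcal{A}\to\mathcal{B}$. Then $\mathrm{IMS}(\mathcal{B},\mathcal{A},E)$ is finite. In particular, for the iterated tower of basic constructions $\mathcal{A}_{-1}=\mathcal{B}\subset\mathcal{A}_0=\mathcal{A}\subset\mathcal{A}_1\subset\mathcal{A}_2\subset\cdots$ with conditional expectations $E_k:\mathcal{A}_k\to\mathcal{A}_{k-1}$, the set $\mathrm{IMS}(\mathcal{A}_k,\mathcal{A}_{k+1},E_{k+1})$ is finite for every $k\geq 0$.
   Context: An inclusion $\mathcal{B}\subset\mathcal{A}$ of unital $C^*$-algebras with common unit is irreducible if the relative commutant $\mathcal{B}'\cap\mathcal{A}=\{x\in\mathcal{A}:bx=xb\ \forall b\in\mathcal{B}\}$ equals $\mathbb{C}\mathbf{1}$. A conditional expectation $E:\mathcal{A}\to\mathcal{B}$ has finite index if there is a finite set $\{\lambda_1,\dots,\lambda_n\}\subset\mathcal{A}$ (a quasi-basis) with $x=\sum_i E(x\lambda_i)\lambda_i^*$ for all $x\in\mathcal{A}$; its Watatani index is $\mathrm{Ind}_W(E)=\sum_i\lambda_i\lambda_i^*$, a positive invertible element of $\mathcal{Z}(\mathcal{A})$ independent of the quasi-basis. $\mathrm{IMS}(\mathcal{B},\mathcal{A},E)$ is the set of intermediate $C^*$-subalgebras $\mathcal{B}\subseteq\mathcal{C}\subseteq\mathcal{A}$ for which there exists a conditional expectation $F$ from $\mathcal{A}$ onto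 $\mathcal{C}$ with $E|_{\mathcal{C}}\circ F=E$. Basic construction: for finite-index $E:\mathcal{A}\to\mathcal{B}$, regard $\mathcal{A}$ as a Hilbert $\mathcal{B}$-module with $\langle x,y\rangle_{\mathcal{B}}=E(x^*y)$, let $\mathcal{L}_{\mathcal{B}}(\mathcal{A})$ be the $C^*$-algebra of adjointable maps on it, embed $\mathcal{A}\subset\mathcal{L}_{\mathcal{B}}(\mathcal{A})$ by left multiplication, and let $e_1\in\mathcal{L}_{\mathcal{B}}(\mathcal{A})$ be the (Jones) projection $x\mapsto E(x)$. The $C^*$-basic construction is $\mathcal{A}_1=\mathrm{span}\{xe_1y:x,y\in\mathcal{A}\}=C^*(\mathcal{A},e_1)=\mathcal{L}_{\mathcal{B}}(\mathcal{A})$, and the dual conditional expectation $\widetilde{E}:\mathcal{A}_1\to\mathcal{A}$ is the unique finite-index conditional expectation with $\widetilde{E}(xe_1y)=\mathrm{Ind}_W(E)^{-1}xy$ for $x,y\in\mathcal{A}$. Iterating, with $\mathcal{A}_{-1}=\mathcal{B}$, $\mathcal{A}_0=\mathcal{A}$, $E_0=E$: $\mathcal{A}_{k+1}$ is the basic construction of $\mathcal{A}_{k-1}\subset\mathcal{A}_k$ with respect to $E_k$, and $E_{k+1}:\mathcal{A}_{k+1}\to\mathcal{A}_k$ is the dual of $E_k$, for $k\ge 0$. *)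

theory Defs
  imports "HOL-Analysis.Analysis" "HOL-Library.FuncSet"
begin

class unital_cstar_algebra = real_normed_algebra_1 + banach +
  fixes scaleC :: "complex \<Rightarrow> 'a \<Rightarrow> 'a" (infixr "*\<^sub>C" 75)
    and star :: "'a \<Rightarrow> 'a"
  assumes scaleC_add_right: "c *\<^sub>C (x + y) = c *\<^sub>C x + c *\<^sub>C y"
    and scaleC_add_left: "(c + d) *\<^sub>C x = c *\<^sub>C x + d *\<^sub>C x"
    and scaleC_scaleC: "c *\<^sub>C (d *\<^sub>C x) = (c * d) *\<^sub>C x"
    and scaleC_of_real: "complex_of_real r *\<^sub>C x = r *\<^sub>R x"
    and scaleC_mult_left: "(c *\<^sub>C x) * y = c *\<^sub>C (x * y)"
    and scaleC_mult_right: "x * (c *\<^sub>C y) = c *\<^sub>C (x * y)"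
    and norm_scaleC: "norm (c *\<^sub>C x) = cmod c * norm x"
    and star_star: "star (star x) = x"
    and star_add: "star (x + y) = star x + star y"
    and star_scaleC: "star (c *\<^sub>C x) = cnj c *\<^sub>C star x"
    and star_mult: "star (x * y) = star y * star x"
    and cstar_identity: "norm (star x * x) = (norm x)\<^sup>2"

instantiation complex :: unital_cstar_algebra
begin

definition scaleC_complex :: "complex \<Rightarrow> complex \<Rightarrow> complex"
  where "scaleC_complex c x = c * x"

definition star_complex :: "complex \<Rightarrow> complex"
  where "star_complex = cnj"

instance
  by standard
    (simp_all add: scaleC_complex_def star_complex_def algebra_simps norm_mult
      power2_eq_square scaleR_conv_of_real)

end

text \<open>All algebras below are carried by subsets of a type of class
  \<^class>\<open>unital_cstar_algebra\<close>, and all maps are total functions of which only the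
  values on the relevant subset matter.\<close>

definition cstar_subalgebra :: "'a::unital_cstar_algebra set \<Rightarrow> bool" where
  "cstar_subalgebra C \<longleftrightarrow>
     0 \<in> C \<and>
     (\<forall>x\<in>C. \<forall>y\<in>C. x + y \<in> C) \<and>
     (\<forall>c. \<forall>x\<in>C. c *\<^sub>C x \<in> C) \<and>
     (\<forall>x\<in>C. \<forall>y\<in>C. x * y \<in> C) \<and>
     (\<forall>x\<in>C. star x \<in> C) \<and>
     closed C"

definition unital_inclusion :: "'a::unital_cstar_algebra set \<Rightarrow> 'a set \<Rightarrow> bool" where
  "unital_inclusion B A \<longleftrightarrow>
     cstar_subalgebra B \<and> cstar_subalgebra A \<and> 1 \<in> B \<and> B \<subseteq> A"

definition relative_commutant :: "'a::unital_cstar_algebra set \<Rightarrow> 'a set \<Rightarrow> 'a set" where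
  "relative_commutant B A = {x \<in> A. \<forall>b\<in>B. b * x = x * b}"

definition irreducible_inclusion :: "'a::unital_cstar_algebra set \<Rightarrow> 'a set \<Rightarrow> bool" where
  "irreducible_inclusion B A \<longleftrightarrow>
     unital_inclusion B A \<and> relative_commutant B A = range (\<lambda>c. c *\<^sub>C 1)"

definition positive_elements :: "'a::unital_cstar_algebra set \<Rightarrow> 'a set" where
  "positive_elements A = {star y * y |y. y \<in> A}"

text \<open>A conditional expectation is a positive contractive projection of \<open>A\<close> onto \<open>B\<close> that is
  a \<open>B\<close>-bimodule map. The clauses are not independent (Tomiyama).\<close>

definition conditional_expectation ::
  "'a::unital_cstar_algebra set \<Rightarrow> 'a set \<Rightarrow> ('a \<Rightarrow> 'a) \<Rightarrow> bool" where
  "conditional_expectation A B E \<longleftrightarrow>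
     (\<forall>x\<in>A. E x \<in> B) \<and>
     (\<forall>b\<in>B. E b = b) \<and>
     (\<forall>x\<in>A. \<forall>y\<in>A. E (x + y) = E x + E y) \<and>
     (\<forall>c. \<forall>x\<in>A. E (c *\<^sub>C x) = c *\<^sub>C E x) \<and>
     (\<forall>b\<in>B. \<forall>x\<in>A. \<forall>c\<in>B. E (b * x * c) = b * E x * c) \<and>
     (\<forall>x\<in>positive_elements A. E x \<in> positive_elements B) \<and>
     (\<forall>x\<in>A. norm (E x) \<le> norm x)"

definition quasi_basis ::
  "'a::unital_cstar_algebra set \<Rightarrow> ('a \<Rightarrow> 'a) \<Rightarrow> nat \<Rightarrow> (nat \<Rightarrow> 'a) \<Rightarrow> bool" where
  "quasi_basis A E n l \<longleftrightarrow>
     (\<forall>i<n. l i \<in> A) \<and> (\<forall>x\<in>A. x = (\<Sum>i<n. E (x * l i) * star (l i)))"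

definition finite_index :: "'a::unital_cstar_algebra set \<Rightarrow> ('a \<Rightarrow> 'a) \<Rightarrow> bool" where
  "finite_index A E \<longleftrightarrow> (\<exists>n l. quasi_basis A E n l)"

definition watatani_index :: "'a::unital_cstar_algebra set \<Rightarrow> ('a \<Rightarrow> 'a) \<Rightarrow> 'a" where
  "watatani_index A E =
     (THE w. \<exists>n l. quasi_basis A E n l \<and> w = (\<Sum>i<n. l i * star (l i)))"

definition IMS ::
  "'a::unital_cstar_algebra set \<Rightarrow> 'a set \<Rightarrow> ('a \<Rightarrow> 'a) \<Rightarrow> 'a set set" where
  "IMS B A E =
     {C. cstar_subalgebra C \<and> B \<subseteq> C \<and> C \<subseteq> A \<and>
         (\<exists>F. conditional_expectation A C F \<and> (\<forall>x\<in>A. E (F x) = E x))}"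

text \<open>Adjointness for the \<open>B\<close>-valued inner product \<open>\<langle>x, y\<rangle> = E (star x * y)\<close> on \<open>A\<close>.
  Adjointable maps are automatically bounded and right \<open>B\<close>-linear. They are represented by
  extensional functions on \<open>A\<close>, so that equality of representatives is equality of maps.\<close>

definition module_adjoint ::
  "'a::unital_cstar_algebra set \<Rightarrow> ('a \<Rightarrow> 'a) \<Rightarrow> ('a \<Rightarrow> 'a) \<Rightarrow> ('a \<Rightarrow> 'a) \<Rightarrow> bool" where
  "module_adjoint A E t s \<longleftrightarrow>
     (\<forall>x\<in>A. \<forall>y\<in>A. E (star (t x) * y) = E (star x * s y))"

definition adjointable_maps ::
  "'a::unital_cstar_algebra set \<Rightarrow> ('a \<Rightarrow> 'a) \<Rightarrow> ('a \<Rightarrow> 'a) set" where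
  "adjointable_maps A E = {t \<in> A \<rightarrow>\<^sub>E A. \<exists>s \<in> A \<rightarrow>\<^sub>E A. module_adjoint A E t s}"

text \<open>\<open>A1\<close> with \<open>e\<close> is (a copy of) the basic construction of \<open>E\<close>: \<open>p\<close> is a \<open>*\<close>-isomorphism of
  \<open>A1\<close> onto the algebra of adjointable maps, under which the inclusion of \<open>A\<close> into \<open>A1\<close> becomes
  the left multiplication embedding, and \<open>e\<close> becomes the Jones projection. A \<open>*\<close>-isomorphism of
  \<open>C\<^sup>*\<close>-algebras is isometric, so the norm needs no separate clause.\<close>

definition basic_construction ::
  "'a::unital_cstar_algebra set \<Rightarrow> ('a \<Rightarrow> 'a) \<Rightarrow> 'a set \<Rightarrow> 'a \<Rightarrow> bool" where
  "basic_construction A E A1 e \<longleftrightarrow>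
     unital_inclusion A A1 \<and> e \<in> A1 \<and>
     (\<exists>p. bij_betw p A1 (adjointable_maps A E) \<and>
          (\<forall>x\<in>A1. \<forall>y\<in>A1. p (x + y) = (\<lambda>a\<in>A. p x a + p y a)) \<and>
          (\<forall>c. \<forall>x\<in>A1. p (c *\<^sub>C x) = (\<lambda>a\<in>A. c *\<^sub>C p x a)) \<and>
          (\<forall>x\<in>A1. \<forall>y\<in>A1. p (x * y) = compose A (p x) (p y)) \<and>
          (\<forall>x\<in>A1. module_adjoint A E (p x) (p (star x))) \<and>
          (\<forall>x\<in>A. p x = (\<lambda>a\<in>A. x * a)) \<and>
          p e = (\<lambda>a\<in>A. E a))"

definition inverse_in :: "'a::unital_cstar_algebra set \<Rightarrow> 'a \<Rightarrow> 'a" where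
  "inverse_in A x = (THE y. y \<in> A \<and> x * y = 1 \<and> y * x = 1)"

definition dual_expectation ::
  "'a::unital_cstar_algebra set \<Rightarrow> ('a \<Rightarrow> 'a) \<Rightarrow> 'a set \<Rightarrow> 'a \<Rightarrow> ('a \<Rightarrow> 'a) \<Rightarrow> bool" where
  "dual_expectation A E A1 e F \<longleftrightarrow>
     conditional_expectation A1 A F \<and> finite_index A1 F \<and>
     (\<forall>x\<in>A. \<forall>y\<in>A. F (x * e * y) = inverse_in A (watatani_index A E) * x * y)"

definition star_isomorphism ::
  "'a::unital_cstar_algebra set \<Rightarrow> 'b::unital_cstar_algebra set \<Rightarrow> ('a \<Rightarrow> 'b) \<Rightarrow> bool" where
  "star_isomorphism A A' f \<longleftrightarrow>
     bij_betw f A A' \<and>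
     (\<forall>x\<in>A. \<forall>y\<in>A. f (x + y) = f x + f y) \<and>
     (\<forall>c. \<forall>x\<in>A. f (c *\<^sub>C x) = c *\<^sub>C f x) \<and>
     (\<forall>x\<in>A. \<forall>y\<in>A. f (x * y) = f x * f y) \<and>
     (\<forall>x\<in>A. f (star x) = star (f x))"

text \<open>The tower of iterated basic constructions is determined up to isomorphism. It is realised
  as an increasing sequence \<open>T (-1) \<subseteq> T 0 \<subseteq> T 1 \<subseteq> \<dots>\<close> inside some \<open>C\<^sup>*\<close>-algebra, for instance
  the inductive limit. That algebra may have a different type from the one carrying \<open>A\<close>, so
  \<open>T (-1) \<subseteq> T 0\<close> with \<open>F 0\<close> is a copy of \<open>B \<subseteq> A\<close> with \<open>E\<close> via the isomorphism \<open>f\<close>; with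
  \<open>f = id\<close> it is that inclusion itself.\<close>

definition basic_construction_tower ::
  "'a::unital_cstar_algebra set \<Rightarrow> 'a set \<Rightarrow> ('a \<Rightarrow> 'a) \<Rightarrow>
   ('a \<Rightarrow> 'b::unital_cstar_algebra) \<Rightarrow> (int \<Rightarrow> 'b set) \<Rightarrow> (int \<Rightarrow> 'b \<Rightarrow> 'b) \<Rightarrow> bool" where
  "basic_construction_tower B A E f T F \<longleftrightarrow>
     unital_inclusion (T (- 1)) (T 0) \<and>
     star_isomorphism A (T 0) f \<and> f ` B = T (- 1) \<and> (\<forall>x\<in>A. F 0 (f x) = f (E x)) \<and>
     (\<forall>k\<ge>0. \<exists>e. basic_construction (T k) (F k) (T (k + 1)) e \<and>
                 dual_expectation (T k) (F k) (T (k + 1)) e (F (k + 1)))"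

end

theory Submission
  imports Defs
begin

text \<open>Let \<open>l\<close> be a quasi-basis of \<open>E\<close>. By irreducibility, \<open>\<Sum>k. T (l k) * star (S (l k))\<close> is a scalar
  for any two \<open>B\<close>-bimodule maps \<open>S\<close>, \<open>T\<close> of \<open>A\<close>; this inner product makes the bimodule maps a
  Hilbert space, in which orthonormal families have bounded size because the index is finite. So an
  infinite set of intermediate subalgebras would contain two distinct \<open>C\<close>, \<open>D\<close> whose expectations
  \<open>F\<close>, \<open>G\<close> are arbitrarily close. Then \<open>id - G\<close> restricted to \<open>C\<close> is small and is a derivation up to
  second order. Averaging over a quasi-basis of \<open>C\<close> shows it to be inner up to second order and
  implemented by an element of the relative commutant of \<open>B\<close>, which is a scalar; hence it is
  dominated by its own square and vanishes, so \<open>C \<subseteq> D\<close>, and \<open>C = D\<close> by symmetry. Irreducibility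
  passes up the tower, because an element of the basic construction commuting with \<open>A\<close> is right
  multiplication by an element of the relative commutant of \<open>B\<close>.\<close>

section \<open>Positive elements\<close>

lemma scaleC_one [simp]: "1 *\<^sub>C x = (x::'a::unital_cstar_algebra)"
  using scaleC_of_real[of 1 x] by simp

lemma scaleC_zero_left [simp]: "0 *\<^sub>C x = (0::'a::unital_cstar_algebra)"
  using scaleC_of_real[of 0 x] by simp

lemma scaleC_minus_one: "(-1) *\<^sub>C x = - (x::'a::unital_cstar_algebra)"
  using scaleC_of_real[of "-1" x] by simp

lemma scaleC_zero_right [simp]: "c *\<^sub>C (0::'a::unital_cstar_algebra) = 0"
  using scaleC_add_right[of c "0::'a" 0] by simp

lemma scaleC_minus_right: "c *\<^sub>C (- x) = - (c *\<^sub>C (x::'a::unital_cstar_algebra))"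
  using scaleC_add_right[of c x "- x"] by (simp add: eq_neg_iff_add_eq_0 add.commute)

lemma scaleC_diff_right: "c *\<^sub>C (x - y) = c *\<^sub>C x - c *\<^sub>C (y::'a::unital_cstar_algebra)"
  using scaleC_add_right[of c x "- y"] by (simp add: scaleC_minus_right)

lemma scaleC_minus_left: "(- c) *\<^sub>C x = - (c *\<^sub>C (x::'a::unital_cstar_algebra))"
  using scaleC_scaleC[of "-1" c x] by (simp add: scaleC_minus_one)

lemma scaleC_diff_left: "(c - d) *\<^sub>C x = c *\<^sub>C x - d *\<^sub>C (x::'a::unital_cstar_algebra)"
  using scaleC_add_left[of c "- d" x] by (simp add: scaleC_minus_left)

lemma scaleC_sum_left: "(\<Sum>i\<in>I. c i) *\<^sub>C x = (\<Sum>i\<in>I. c i *\<^sub>C (x::'a::unital_cstar_algebra))"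
  by (induction I rule: infinite_finite_induct) (auto simp: scaleC_add_left)

lemma scaleC_sum_right: "c *\<^sub>C (\<Sum>i\<in>I. x i) = (\<Sum>i\<in>I. c *\<^sub>C (x i::'a::unital_cstar_algebra))"
  by (induction I rule: infinite_finite_induct) (auto simp: scaleC_add_right)

lemma scaleC_one_eq_iff [simp]:
  "c *\<^sub>C (1::'a::unital_cstar_algebra) = d *\<^sub>C 1 \<longleftrightarrow> c = d"
proof
  assume "c *\<^sub>C (1::'a) = d *\<^sub>C 1"
  hence "norm ((c - d) *\<^sub>C (1::'a)) = 0" by (simp add: scaleC_diff_left)
  thus "c = d" by (simp add: norm_scaleC)
qed simp

lemma star_zero [simp]: "star (0::'a::unital_cstar_algebra) = 0"
  using star_add[of "0::'a" 0] by simp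

lemma star_minus: "star (- x) = - star (x::'a::unital_cstar_algebra)"
  using star_add[of x "- x"] by (simp add: eq_neg_iff_add_eq_0 add.commute)

lemma star_diff: "star (x - y) = star x - star (y::'a::unital_cstar_algebra)"
  using star_add[of x "- y"] by (simp add: star_minus)

lemma star_one [simp]: "star (1::'a::unital_cstar_algebra) = 1"
  using star_mult[of "star (1::'a)" 1] by (simp add: star_star)

lemma star_scaleR: "star (r *\<^sub>R x) = r *\<^sub>R star (x::'a::unital_cstar_algebra)"
  using star_scaleC[of "complex_of_real r" x] by (simp add: scaleC_of_real)

lemma star_sum: "star (\<Sum>i\<in>I. f i) = (\<Sum>i\<in>I. star (f i::'a::unital_cstar_algebra))"
  by (induction I rule: infinite_finite_induct) (auto simp: star_add)

text \<open>The C*-identity and submultiplicativity give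
  \<open>(norm y)\<^sup>2 \<le> norm (star y) * norm y\<close>; cancelling \<open>norm y\<close> and
  applying this to both \<open>x\<close> and \<open>star x\<close> gives equality.\<close>

lemma norm_star [simp]: "norm (star x) = norm (x::'a::unital_cstar_algebra)"
proof -
  have "norm y \<le> norm (star y)" for y :: 'a
  proof (cases "y = 0")
    case False
    have "norm y * norm y \<le> norm (star y) * norm y"
      using norm_mult_ineq[of "star y" y] by (simp add: cstar_identity power2_eq_square)
    thus ?thesis using False by simp
  qed simp
  from this[of x] this[of "star x"] show ?thesis by (simp add: star_star)
qed

lemma cstar_identity': "norm (x * star x) = (norm (x::'a::unital_cstar_algebra))\<^sup>2"
  using cstar_identity[of "star x"] by (simp add: star_star)

lemma norm_selfadjoint_square:
  "star t = t \<Longrightarrow> norm (t * t) = (norm (t::'a::unital_cstar_algebra))\<^sup>2"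
  using cstar_identity[of t] by simp

lemma square_eq_zero_selfadjoint:
  "star t = t \<Longrightarrow> t * t = 0 \<Longrightarrow> (t::'a::unital_cstar_algebra) = 0"
  using norm_selfadjoint_square[of t] by simp

lemma tendsto_star:
  assumes "(f \<longlongrightarrow> (x::'a::unital_cstar_algebra)) G"
  shows "((\<lambda>n. star (f n)) \<longlongrightarrow> star x) G"
proof -
  have "((\<lambda>n. norm (f n - x)) \<longlongrightarrow> 0) G"
    using assms by (simp add: LIM_zero tendsto_norm_zero)
  hence "((\<lambda>n. norm (star (f n) - star x)) \<longlongrightarrow> 0) G"
    by (simp add: star_diff[symmetric])
  thus ?thesis using LIM_zero_cancel tendsto_norm_zero_iff by blast
qed

section \<open>Square roots by iteration\<close>

text \<open>The solution \<open>y\<close> of \<open>y = (z + y\<^sup>2) / 2\<close> is found by iteration; the iterates are dominated by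
  those of the scalar equation \<open>s = (1 + s\<^sup>2) / 2\<close>, which converge although its fixed point
  \<open>s = 1\<close> is not attracting.\<close>

primrec sqrt_iter :: "'a::real_normed_algebra_1 \<Rightarrow> nat \<Rightarrow> 'a" where
  "sqrt_iter z 0 = 0"
| "sqrt_iter z (Suc n) = (1/2) *\<^sub>R (z + sqrt_iter z n * sqrt_iter z n)"

lemma sqrt_iter_one_bounds: "0 \<le> sqrt_iter (1::real) n \<and> sqrt_iter (1::real) n \<le> 1"
proof (induction n)
  case (Suc n)
  thus ?case by (simp add: mult_le_one)
qed simp

lemma sqrt_iter_commute:
  assumes "y * z = z * (y::'a::real_normed_algebra_1)"
  shows "y * sqrt_iter z n = sqrt_iter z n * y"
proof (induction n)
  case (Suc n)
  have "y * (sqrt_iter z n * sqrt_iter z n) = sqrt_iter z n * sqrt_iter z n * y"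
    by (metis Suc mult.assoc)
  thus ?case using assms by (simp add: algebra_simps)
qed simp

lemma norm_sqrt_iter_le:
  assumes "norm (z::'a::real_normed_algebra_1) \<le> 1"
  shows "norm (sqrt_iter z n) \<le> sqrt_iter 1 n"
proof (induction n)
  case (Suc n)
  have "norm (sqrt_iter z n * sqrt_iter z n) \<le> sqrt_iter 1 n * sqrt_iter 1 n"
    using Suc by (meson mult_mono norm_ge_zero norm_mult_ineq order_trans)
  hence "norm (z + sqrt_iter z n * sqrt_iter z n) \<le> 1 + sqrt_iter 1 n * sqrt_iter 1 n"
    using assms norm_triangle_ineq[of z "sqrt_iter z n * sqrt_iter z n"] by linarith
  thus ?case by simp
qed simp

text \<open>The iterates commute with each other, so a difference of their squares factors as in the
  scalar case. Each factor is then dominated by its scalar counterpart.\<close>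

lemma norm_sqrt_iter_step:
  assumes "norm (z::'a::real_normed_algebra_1) \<le> 1"
  shows "norm (sqrt_iter z (Suc n) - sqrt_iter z n) \<le> sqrt_iter 1 (Suc n) - sqrt_iter 1 n"
proof (induction n)
  case 0
  thus ?case using assms by simp
next
  case (Suc n)
  let ?y = "sqrt_iter z" and ?s = "sqrt_iter (1::real)"
  have c: "?y (Suc n) * ?y n = ?y n * ?y (Suc n)"
    by (rule sqrt_iter_commute) (rule sqrt_iter_commute[symmetric], simp)
  have "?y (Suc (Suc n)) - ?y (Suc n)
      = (1/2) *\<^sub>R (?y (Suc n) * ?y (Suc n) - ?y n * ?y n)"
    by (simp only: sqrt_iter.simps(2)[of z "Suc n"] sqrt_iter.simps(2)[of z n])
      (simp add: algebra_simps)
  also have "\<dots> = (1/2) *\<^sub>R ((?y (Suc n) - ?y n) * (?y (Suc n) + ?y n))"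
    using c by (simp only: algebra_simps) 
  finally have "norm (?y (Suc (Suc n)) - ?y (Suc n))
      = (1/2) * norm ((?y (Suc n) - ?y n) * (?y (Suc n) + ?y n))"
    by simp
  also have "\<dots> \<le> (1/2) * ((?s (Suc n) - ?s n) * (?s (Suc n) + ?s n))"
  proof -
    have "norm (?y (Suc n) + ?y n) \<le> ?s (Suc n) + ?s n"
      by (intro norm_triangle_mono norm_sqrt_iter_le assms)
    moreover have "0 \<le> ?s (Suc n) - ?s n"
      using Suc norm_ge_zero order_trans by blast
    ultimately have "norm (?y (Suc n) - ?y n) * norm (?y (Suc n) + ?y n)
        \<le> (?s (Suc n) - ?s n) * (?s (Suc n) + ?s n)"
      by (intro mult_mono Suc) auto
    thus ?thesis
      using norm_mult_ineq[of "?y (Suc n) - ?y n" "?y (Suc n) + ?y n"] by linarith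
  qed
  also have "\<dots> = ?s (Suc (Suc n)) - ?s (Suc n)"
    by (simp only: sqrt_iter.simps(2)[of 1 "Suc n"] sqrt_iter.simps(2)[of 1 n])
      (simp add: field_simps)
  finally show ?case .
qed

text \<open>The scalar iterates increase and are bounded by 1, so their increments are summable.
  They dominate the increments of the iterates of \<open>z\<close>, also in the boundary case
  \<open>norm z = 1\<close>.\<close>

lemma sqrt_iter_convergent:
  assumes "norm (z::'a::{real_normed_algebra_1,banach}) \<le> 1"
  shows "convergent (sqrt_iter z)"
proof -
  let ?s = "sqrt_iter (1::real)"
  have mono: "incseq ?s"
  proof (rule incseq_SucI)
    fix n
    have "0 \<le> ?s (Suc n) - ?s n"
      using norm_sqrt_iter_step[of "1::real" n] norm_ge_zero order_trans by force
    thus "?s n \<le> ?s (Suc n)" by simp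
  qed
  then obtain L where "?s \<longlonglongrightarrow> L"
    using incseq_convergent[OF mono, of 1] sqrt_iter_one_bounds by blast
  hence conv: "summable (\<lambda>n. ?s (Suc n) - ?s n)"
    using telescope_summable by blast
  have "summable (\<lambda>n. sqrt_iter z (Suc n) - sqrt_iter z n)"
    by (rule summable_comparison_test'[OF conv]) (rule norm_sqrt_iter_step[OF assms])
  thus ?thesis
    by (simp add: summable_iff_convergent sum_lessThan_telescope flip: lessThan_Suc_atMost
        del: sqrt_iter.simps(2))
qed

text \<open>The limit \<open>Y\<close> satisfies \<open>Y + Y = z + Y * Y\<close>, which says that
  \<open>1 - Y\<close> squares to \<open>1 - z\<close>. The remaining properties pass from the
  iterates to the limit.\<close>

lemma selfadjoint_sqrt_exists:
  fixes z :: "'a::unital_cstar_algebra"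
  assumes "star z = z" and "norm z \<le> 1"
  obtains w where "star w = w" "w * w = 1 - z" "norm (1 - w) \<le> 1"
    "\<And>y. y * z = z * y \<Longrightarrow> y * w = w * y"
proof -
  obtain Y where Y: "sqrt_iter z \<longlonglongrightarrow> Y"
    using sqrt_iter_convergent[OF assms(2)] by (auto simp: convergent_def)
  have "(\<lambda>n. sqrt_iter z (Suc n)) \<longlonglongrightarrow> (1/2) *\<^sub>R (z + Y * Y)"
    unfolding sqrt_iter.simps by (intro tendsto_intros Y)
  hence Y_eq: "Y = (1/2) *\<^sub>R (z + Y * Y)"
    using LIMSEQ_Suc[OF Y] LIMSEQ_unique by blast
  hence Y2: "Y + Y = z + Y * Y"
    by (metis scaleR_half_double scaleR_right_distrib)
  have "star (sqrt_iter z n) = sqrt_iter z n" for n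
    by (induction n) (simp_all add: star_scaleR star_add star_mult assms)
  hence 1: "star Y = Y"
    using tendsto_star[OF Y] Y LIMSEQ_unique by simp
  have 2: "norm Y \<le> 1"
    by (rule LIMSEQ_le_const2[OF tendsto_norm[OF Y]])
      (meson norm_sqrt_iter_le[OF assms(2)] order_trans sqrt_iter_one_bounds)
  have 3: "y * Y = Y * y" if "y * z = z * y" for y
  proof -
    have "(\<lambda>n. y * sqrt_iter z n) \<longlonglongrightarrow> y * Y" by (intro tendsto_intros Y)
    moreover have "(\<lambda>n. sqrt_iter z n * y) \<longlonglongrightarrow> Y * y" by (intro tendsto_intros Y)
    ultimately show ?thesis
      using LIMSEQ_unique sqrt_iter_commute[OF that] by simp
  qed
  show ?thesis
  proof (rule that[of "1 - Y"])
    show "(1 - Y) * (1 - Y) = 1 - z"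
      using Y2 by (simp add: algebra_simps)
  qed (use 1 2 3 in \<open>auto simp: star_diff algebra_simps\<close>)
qed

section \<open>The cone of positive elements and positivity of \<open>star y * y\<close>\<close>

text \<open>Commutation of the square root with the whole commutant makes the square roots of commuting
  positive elements commute; the norm condition makes the square root itself positive.\<close>

definition pos :: "'a::unital_cstar_algebra \<Rightarrow> bool" where
  "pos z \<longleftrightarrow> (\<exists>t. star t = t \<and> z = t * t \<and> (\<forall>y. y * z = z * y \<longrightarrow> y * t = t * y) \<and>
     (\<exists>s>0. norm (s *\<^sub>R 1 - t) \<le> s))"

lemma posE:
  assumes "pos z"
  obtains t where "star t = t" "z = t * t" "\<And>y. y * z = z * y \<Longrightarrow> y * t = t * y"
  using assms unfolding pos_def by blast

text \<open>The norm bound says that \<open>z = r *\<^sub>R (1 - z')\<close> with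
  \<open>norm z' \<le> 1\<close>, so \<open>sqrt r\<close> times the square root of
  \<open>1 - z'\<close> is a root of \<open>z\<close>. This norm criterion takes the place of the
  spectrum.\<close>

lemma posI_norm:
  assumes "star z = z" "r > 0" "norm (r *\<^sub>R 1 - z) \<le> r"
  shows "pos (z::'a::unital_cstar_algebra)"
proof -
  define z' where "z' = 1 - (1/r) *\<^sub>R z"
  have z': "z' = (1/r) *\<^sub>R (r *\<^sub>R 1 - z)"
    using assms(2) by (simp add: z'_def algebra_simps)
  have "norm z' \<le> 1" using assms(2,3) unfolding z' norm_scaleR by (simp add: field_simps)
  moreover have "star z' = z'" by (simp add: z'_def star_diff star_scaleR assms)
  ultimately obtain w where w: "star w = w" "w * w = 1 - z'" "norm (1 - w) \<le> 1"
    "\<And>y. y * z' = z' * y \<Longrightarrow> y * w = w * y"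
    using selfadjoint_sqrt_exists by metis
  let ?t = "sqrt r *\<^sub>R w"
  have "z = ?t * ?t" using w(2) assms(2) by (simp add: z'_def)
  moreover have "y * ?t = ?t * y" if "y * z = z * y" for y
    using w(4)[of y] that by (simp add: z'_def algebra_simps)
  moreover have "norm (sqrt r *\<^sub>R 1 - ?t) \<le> sqrt r"
  proof -
    have "sqrt r *\<^sub>R 1 - ?t = sqrt r *\<^sub>R (1 - w)" by (simp add: algebra_simps)
    hence "norm (sqrt r *\<^sub>R 1 - ?t) = sqrt r * norm (1 - w)" using assms(2) by simp
    thus ?thesis using w(3) assms(2) mult_left_le[of "norm (1 - w)" "sqrt r"] by simp
  qed
  moreover have "star ?t = ?t" by (simp add: star_scaleR w(1))
  moreover have "sqrt r > 0" using assms(2) by simp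
  ultimately show ?thesis unfolding pos_def by blast
qed

text \<open>Commuting self-adjoint \<open>h\<close> and \<open>m\<close> are the real and imaginary
  parts of a normal element \<open>v\<close>, for which
  \<open>star v * v = h * h + m * m\<close>.\<close>

lemma norm_adjoin_imaginary:
  assumes "star h = h" "star m = m" "h * m = m * (h::'a::unital_cstar_algebra)"
  shows "(norm (h + \<i> *\<^sub>C m))\<^sup>2 = norm (h * h + m * m)"
proof -
  have "star (h + \<i> *\<^sub>C m) * (h + \<i> *\<^sub>C m) = h * h + m * m"
    by (simp add: star_add star_scaleC assms algebra_simps scaleC_diff_right scaleC_mult_left
        scaleC_mult_right scaleC_scaleC scaleC_minus_left scaleC_minus_one)
  thus ?thesis using cstar_identity[of "h + \<i> *\<^sub>C m"] by simp
qed

text \<open>With \<open>w\<close> a root of \<open>1 - t * t\<close>, the element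
  \<open>u = t + \<i> *\<^sub>C w\<close> has norm 1. The double angle formula for sin^2 becomes
  \<open>1 - t * t = (1/2) *\<^sub>R 1 - (1/4) *\<^sub>R (u * u + star u * star u)\<close>, and the
  triangle inequality finishes.\<close>

lemma norm_one_minus_square_le:
  assumes "star t = t" "norm (t::'a::unital_cstar_algebra) \<le> 1"
  shows "norm (1 - t * t) \<le> 1"
proof -
  have "norm (t * t) \<le> 1" using assms by (simp add: norm_selfadjoint_square power_le_one)
  moreover have "star (t * t) = t * t" by (simp add: star_mult assms)
  ultimately obtain w where w: "star w = w" "w * w = 1 - t * t"
    "\<And>y. y * (t * t) = (t * t) * y \<Longrightarrow> y * w = w * y"
    using selfadjoint_sqrt_exists by metis
  have tw: "t * w = w * t" by (rule w(3)) (simp add: mult.assoc)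
  define u where "u = t + \<i> *\<^sub>C w"
  have "(norm u)\<^sup>2 = 1"
    unfolding u_def by (simp add: norm_adjoin_imaginary assms w(1) tw w(2))
  hence u: "norm u = 1" by (simp add: power2_eq_1_iff)
      (metis norm_ge_zero not_one_le_zero neg_0_le_iff_le)
  have "u * u + star u * star u = 2 *\<^sub>R (t * t - w * w)"
    by (simp add: u_def star_add star_scaleC assms w(1) algebra_simps scaleC_diff_right scaleC_add_right
        scaleC_mult_left scaleC_mult_right scaleC_scaleC scaleC_minus_left scaleC_minus_one
        scaleR_2)
  also have "\<dots> = 2 *\<^sub>R (t * t - (1 - t * t))" by (simp add: w(2))
  finally have "(1/2) *\<^sub>R 1 - (1/4) *\<^sub>R (u * u + star u * star u)
      = (1/2) *\<^sub>R (1 - (t * t - (1 - t * t)))"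
    by (simp add: scaleR_diff_right)
  also have "1 - (t * t - (1 - t * t)) = (1 - t * t) + (1 - t * t)" by simp
  finally have "(1/2) *\<^sub>R 1 - (1/4) *\<^sub>R (u * u + star u * star u)
      = (1/2) *\<^sub>R ((1 - t * t) + (1 - t * t))" .
  hence *: "1 - t * t = (1/2) *\<^sub>R 1 - (1/4) *\<^sub>R (u * u + star u * star u)"
    by (metis scaleR_half_double)
  have "norm (u * u) \<le> 1" "norm (star u * star u) \<le> 1"
    using norm_mult_ineq[of u u] norm_mult_ineq[of "star u" "star u"] u by simp_all
  hence "norm (u * u + star u * star u) \<le> 2"
    using norm_triangle_ineq[of "u * u" "star u * star u"] by linarith
  thus ?thesis
    unfolding * using norm_triangle_ineq4[of "(1/2) *\<^sub>R (1::'a)" "(1/4) *\<^sub>R (u * u + star u * star u)"]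
    by simp
qed

lemma norm_scalar_minus_square_le:
  assumes "star t = t" "norm (t * t) \<le> r"
  shows "norm (r *\<^sub>R 1 - t * (t::'a::unital_cstar_algebra)) \<le> r"
proof (cases "r > 0")
  case True
  let ?t = "(1 / sqrt r) *\<^sub>R t"
  have "(norm t)\<^sup>2 \<le> r" using assms by (simp add: norm_selfadjoint_square)
  hence "norm t \<le> sqrt r" by (simp add: real_le_rsqrt)
  hence "norm ?t \<le> 1" using True by (simp add: field_simps)
  hence "norm (1 - ?t * ?t) \<le> 1"
    by (intro norm_one_minus_square_le) (simp_all add: star_scaleR assms)
  moreover have "r *\<^sub>R 1 - t * t = r *\<^sub>R (1 - ?t * ?t)"
    using True by (simp add: algebra_simps)
  ultimately show ?thesis using True mult_left_le[of "norm (1 - ?t * ?t)" r] by simp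
next
  case False
  hence "t * t = 0 \<and> r = 0" using assms(2) norm_ge_zero[of "t * t"]
    by (metis linorder_not_le norm_le_zero_iff order_antisym_conv order_trans)
  thus ?thesis by simp
qed

text \<open>Converse of \<open>posI_norm\<close>, for every \<open>r\<close> that bounds the norm.
  Together they make positivity a norm condition, from which closure under sums is
  immediate.\<close>

lemma posD:
  assumes "pos (z::'a::unital_cstar_algebra)"
  shows "star z = z" and "norm z \<le> r \<Longrightarrow> norm (r *\<^sub>R 1 - z) \<le> r"
proof -
  obtain t where t: "star t = t" "z = t * t" using assms by (rule posE)
  show "star z = z" by (simp add: t star_mult)
  show "norm z \<le> r \<Longrightarrow> norm (r *\<^sub>R 1 - z) \<le> r"
    using norm_scalar_minus_square_le[OF t(1)] by (simp add: t(2))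
qed

lemma pos_square: "star t = t \<Longrightarrow> pos (t * (t::'a::unital_cstar_algebra))"
  by (rule posI_norm[of _ "norm (t * t) + 1"])
    (auto simp: star_mult add_nonneg_pos intro: norm_scalar_minus_square_le)

lemma pos_zero [simp]: "pos (0::'a::unital_cstar_algebra)"
  using pos_square[of "0::'a"] by simp

text \<open>The norm criterion adds up by the triangle inequality; the summands 1 keep both radii
  strictly positive.\<close>

lemma pos_add:
  assumes "pos a" "pos b"
  shows "pos (a + (b::'a::unital_cstar_algebra))"
proof (rule posI_norm)
  let ?r = "norm a + 1" and ?s = "norm b + 1"
  have "norm (?r *\<^sub>R 1 - a) \<le> ?r" "norm (?s *\<^sub>R 1 - b) \<le> ?s"
    using assms by (auto intro!: posD(2))
  moreover have "(?r + ?s) *\<^sub>R 1 - (a + b) = (?r *\<^sub>R 1 - a) + (?s *\<^sub>R 1 - b)"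
    by (simp only: scaleR_left_distrib add_diff_add)
  ultimately show "norm ((?r + ?s) *\<^sub>R 1 - (a + b)) \<le> ?r + ?s"
    by (metis norm_triangle_mono)
  show "?r + ?s > 0" by (intro add_pos_pos add_nonneg_pos) auto
qed (use assms in \<open>simp add: star_add posD\<close>)

lemma pos_sum: "(\<And>i. i \<in> I \<Longrightarrow> pos (f i)) \<Longrightarrow> pos (\<Sum>i\<in>I. f i::'a::unital_cstar_algebra)"
  by (induction I rule: infinite_finite_induct) (auto intro: pos_add)

lemma pos_scaleR:
  assumes "pos a" "r \<ge> 0"
  shows "pos (r *\<^sub>R (a::'a::unital_cstar_algebra))"
proof -
  obtain t where t: "star t = t" "a = t * t" using assms(1) by (auto simp: pos_def)
  have "pos ((sqrt r *\<^sub>R t) * (sqrt r *\<^sub>R t))"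
    by (rule pos_square) (simp add: star_scaleR t)
  thus ?thesis using assms(2) by (simp add: t)
qed

lemma pos_scalar_minus:
  assumes "star z = z" "norm z \<le> r" "r > 0"
  shows "pos (r *\<^sub>R 1 - (z::'a::unital_cstar_algebra))"
  by (rule posI_norm[of _ r]) (use assms in \<open>auto simp: star_diff star_scaleR\<close>)

text \<open>For \<open>N\<close> above \<open>norm (a + b)\<close> the element
  \<open>N *\<^sub>R 1 - a\<close> is a sum of two positive ones. Its root \<open>m\<close> commutes
  with a root \<open>h\<close> of \<open>a\<close>, so \<open>h\<close> is the real part of
  \<open>h + \<i> *\<^sub>C m\<close>, whose squared norm is \<open>N\<close>.\<close>

lemma norm_le_add_pos:
  assumes "pos a" "pos b"
  shows "norm a \<le> norm (a + (b::'a::unital_cstar_algebra))"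
proof (rule dense_ge)
  fix N assume N: "norm (a + b) < N"
  hence N0: "N > 0" using norm_ge_zero[of "a + b"] by linarith
  have "pos (N *\<^sub>R 1 - (a + b) + b)"
    using assms N N0 by (intro pos_add pos_scalar_minus) (auto simp: star_add posD)
  hence "pos (N *\<^sub>R 1 - a)" by simp
  then obtain m where m: "star m = m" "N *\<^sub>R 1 - a = m * m"
    "\<And>y. y * (N *\<^sub>R 1 - a) = (N *\<^sub>R 1 - a) * y \<Longrightarrow> y * m = m * y"
    using posE by metis
  obtain h where h: "star h = h" "a = h * h" using assms(1) by (auto simp: pos_def)
  have hm: "h * m = m * h" by (rule m(3)) (simp add: h algebra_simps)
  define v where "v = h + \<i> *\<^sub>C m"
  have "h * h + m * m = N *\<^sub>R 1" using m(2) h(2) by (simp add: algebra_simps)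
  hence v: "(norm v)\<^sup>2 = N"
    unfolding v_def using N0 by (simp add: norm_adjoin_imaginary h(1) m(1) hm)
  have "v + star v = 2 *\<^sub>R h"
    by (simp add: v_def star_add star_scaleC h(1) m(1) scaleC_minus_left scaleR_2)
  hence "2 * norm h \<le> norm v + norm v"
    by (metis norm_scaleR norm_star norm_triangle_ineq abs_numeral)
  hence "(norm h)\<^sup>2 \<le> N" using v by (metis mult_2 mult_le_cancel_left_pos norm_ge_zero power_mono zero_less_numeral)
  thus "norm a \<le> N" by (simp add: h norm_selfadjoint_square)
qed

text \<open>An argument by norms instead of comparing the spectra of \<open>star x * x\<close> and
  \<open>x * star x\<close>. After normalising, \<open>p = y * star y\<close> is positive of norm 1,
  so \<open>p - p * p\<close> is positive and the norm of \<open>p + p * p\<close> is at least that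
  of \<open>2 *\<^sub>R (p * p)\<close>, which is 2. But
  \<open>p + p * p = y * (1 + star y * y) * star y\<close> has norm at most 1.\<close>

lemma eq_zero_if_pos_minus_star_mult:
  assumes "pos (- (star x * x))"
  shows "x = (0::'a::unital_cstar_algebra)"
proof (rule ccontr)
  assume "x \<noteq> 0"
  define y where "y = (1 / norm x) *\<^sub>R x"
  have y1: "norm y = 1" using \<open>x \<noteq> 0\<close> by (simp add: y_def)
  have "- (star y * y) = (1 / (norm x)\<^sup>2) *\<^sub>R - (star x * x)"
    by (simp add: y_def star_scaleR power2_eq_square)
  hence py: "pos (- (star y * y))" using pos_scaleR[OF assms] by simp
  have n1: "norm (1 + star y * y) \<le> 1"
    using posD(2)[OF py, of 1] by (simp add: cstar_identity y1)
  define p where "p = y * star y"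
  have np: "norm p = 1" by (simp add: p_def cstar_identity' y1)
  define s d where "s = y + star y" and "d = \<i> *\<^sub>C (y - star y)"
  have "star s = s" "star d = d"
    by (simp_all add: s_def d_def star_add star_star star_scaleC star_diff scaleC_minus_left
        scaleC_diff_right)
  \<comment> \<open>Up to a factor 2 these are the squared real and imaginary parts of
    \<open>y\<close>; their sum is symmetric in \<open>star y * y\<close> and
    \<open>y * star y\<close>, which turns negativity of the former into positivity of the
    latter.\<close>
  moreover have "s * s + d * d = (p + star y * y) + (p + star y * y)"
    by (simp add: p_def s_def d_def algebra_simps scaleC_mult_left scaleC_mult_right
        scaleC_scaleC scaleC_minus_one scaleC_diff_right)
  hence "p = (1/2) *\<^sub>R (s * s + d * d) + - (star y * y)"
    by (simp only: scaleR_half_double) simp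
  ultimately have pp: "pos p" using py
    by (metis divide_nonneg_nonneg pos_add pos_scaleR pos_square zero_le_numeral zero_le_one)
  then obtain q where q: "star q = q" "p = q * q" by (auto simp: pos_def)
  have "pos (1 - p)" using pos_scalar_minus[of p 1] posD[OF pp] np by simp
  then obtain m where m: "star m = m" "1 - p = m * m"
    "\<And>y. y * (1 - p) = (1 - p) * y \<Longrightarrow> y * m = m * y"
    using posE by metis
  have qm: "q * m = m * q" by (rule m(3)) (simp add: q(2) algebra_simps)
  have "p - p * p = (q * m) * (q * m)"
  proof -
    have "(q * m) * (q * m) = q * (m * m) * q" by (metis qm mult.assoc)
    also have "\<dots> = p - p * p" by (simp add: m(2)[symmetric] q(2) algebra_simps)
    finally show ?thesis ..
  qed
  hence "pos (p - p * p)"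
    using pos_square[of "q * m"] by (simp add: star_mult q m qm)
  moreover have "pos (2 *\<^sub>R (p * p))"
    by (intro pos_scaleR pos_square) (use posD[OF pp] in auto)
  ultimately have "norm (2 *\<^sub>R (p * p)) \<le> norm (2 *\<^sub>R (p * p) + (p - p * p))"
    by (intro norm_le_add_pos)
  also have "2 *\<^sub>R (p * p) + (p - p * p) = y * (1 + star y * y) * star y"
    by (simp add: p_def scaleR_2 algebra_simps)
  also have "norm \<dots> \<le> norm (y * (1 + star y * y))"
    using norm_mult_ineq[of "y * (1 + star y * y)" "star y"] y1 by simp
  also have "\<dots> \<le> 1"
    using norm_mult_ineq[of y "1 + star y * y"] y1 n1 by simp
  finally show False using np posD(1)[OF pp] by (simp add: norm_selfadjoint_square)
qed

text \<open>With \<open>h = star y * y\<close> and \<open>k = \<bar>h\<bar>\<close>, the element \<open>v = k - h\<close> is twice the negative part of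
  \<open>h\<close>, and \<open>x = y * v\<close> satisfies \<open>star x * x = - v * k * v\<close>.\<close>

theorem pos_star_mult: "pos (star y * (y::'a::unital_cstar_algebra))"
proof -
  define h where "h = star y * y"
  have hs: "star h = h" by (simp add: h_def star_mult star_star)
  obtain k s where k: "star k = k" "h * h = k * k"
    "\<And>y. y * (h * h) = h * h * y \<Longrightarrow> y * k = k * y" "s > 0" "norm (s *\<^sub>R 1 - k) \<le> s"
    using pos_square[OF hs] unfolding pos_def by blast
  have hk: "h * k = k * h" by (rule k(3)) (simp add: mult.assoc)
  have pk: "pos k" by (rule posI_norm[OF k(1,4,5)])
  then obtain g where g: "star g = g" "k = g * g" "\<And>y. y * k = k * y \<Longrightarrow> y * g = g * y"
    using posE by metis
  define v where "v = k - h"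
  have vs: "star v = v" by (simp add: v_def star_diff k hs)
  have vg: "v * g = g * v" by (rule g(3)) (simp add: v_def hk algebra_simps)
  have hv: "h * v = - (k * v)" by (simp add: v_def algebra_simps k(2) hk)
  have "star (y * v) * (y * v) = v * (h * v)" by (simp add: star_mult vs h_def mult.assoc)
  also have "\<dots> = - (v * g * g * v)" by (simp add: hv g(2) mult.assoc)
  also have "\<dots> = - ((g * v) * (g * v))" by (metis vg mult.assoc)
  finally have x: "star (y * v) * (y * v) = - ((g * v) * (g * v))" .
  have gvs: "star (g * v) = g * v" by (simp add: star_mult g(1) vs vg)
  have "y * v = 0"
    by (rule eq_zero_if_pos_minus_star_mult) (simp add: x pos_square[OF gvs])
  hence "(g * v) * (g * v) = 0" using x by simp
  hence gv: "g * v = 0" using gvs square_eq_zero_selfadjoint by blast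
  \<comment> \<open>Since \<open>h * v = - (k * v)\<close>, this square is twice
    \<open>k * v\<close>, which vanishes with \<open>g * v\<close>.\<close>
  have "v * v = k * v - h * v" by (simp add: v_def algebra_simps)
  also have "\<dots> = 0" unfolding hv by (simp add: g(2) mult.assoc gv)
  finally have "v = 0" using vs square_eq_zero_selfadjoint by blast
  thus ?thesis using pk by (simp add: v_def h_def)
qed

lemma pos_mult_star: "pos (y * star (y::'a::unital_cstar_algebra))"
  using pos_star_mult[of "star y"] by (simp add: star_star)

lemma norm_le_norm_sum_pos:
  assumes "finite I" "i \<in> I" "\<And>i. i \<in> I \<Longrightarrow> pos (f i)"
  shows "norm (f i) \<le> norm (\<Sum>i\<in>I. f i::'a::unital_cstar_algebra)"
proof -
  have "norm (f i) \<le> norm (f i + sum f (I - {i}))"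
    by (intro norm_le_add_pos pos_sum assms) auto
  thus ?thesis using sum.remove[OF assms(1,2), of f] by simp
qed

text \<open>Self-adjointness makes the scalar a real number \<open>r\<close>, and the norm criterion
  with radius \<open>\<bar>r\<bar>\<close> excludes negative \<open>r\<close>.\<close>

lemma pos_scaleC_one_imp:
  assumes "pos (c *\<^sub>C (1::'a::unital_cstar_algebra))"
  shows "c = complex_of_real (cmod c)"
proof -
  have "cnj c = c" using posD(1)[OF assms] by (simp add: star_scaleC)
  then obtain r where c: "c = complex_of_real r"
    by (metis Reals_cases Reals_cnj_iff)
  have "norm (\<bar>r\<bar> *\<^sub>R 1 - c *\<^sub>C (1::'a)) \<le> \<bar>r\<bar>"
    by (rule posD(2)[OF assms]) (simp add: norm_scaleC c)
  moreover have "\<bar>r\<bar> *\<^sub>R 1 - c *\<^sub>C (1::'a) = (\<bar>r\<bar> - r) *\<^sub>R 1"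
    by (simp add: c scaleC_of_real algebra_simps)
  ultimately have "\<bar>\<bar>r\<bar> - r\<bar> \<le> \<bar>r\<bar>" by simp
  thus ?thesis by (simp add: c)
qed

section \<open>Conditional expectations\<close>

lemma cstar_subalgebra_closed:
  assumes "cstar_subalgebra C"
  shows "0 \<in> C" "x \<in> C \<Longrightarrow> y \<in> C \<Longrightarrow> x + y \<in> C" "x \<in> C \<Longrightarrow> c *\<^sub>C x \<in> C"
    "x \<in> C \<Longrightarrow> y \<in> C \<Longrightarrow> x * y \<in> C" "x \<in> C \<Longrightarrow> star x \<in> C"
  using assms by (auto simp: cstar_subalgebra_def)

lemma cstar_subalgebra_diff:
  assumes "cstar_subalgebra C" "x \<in> C" "y \<in> C"
  shows "x - y \<in> C"
  using cstar_subalgebra_closed(2)[OF assms(1,2) cstar_subalgebra_closed(3)[OF assms(1,3), of "-1"]]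
  by (simp add: scaleC_minus_one)

lemma cstar_subalgebra_sum:
  assumes "cstar_subalgebra C" "\<And>i. i \<in> I \<Longrightarrow> f i \<in> C"
  shows "sum f I \<in> C"
  using assms(2)
  by (induction I rule: infinite_finite_induct) (auto intro: cstar_subalgebra_closed[OF assms(1)])

text \<open>Positivity makes \<open>E (star u * u)\<close> self-adjoint. Polarisation writes four
  times a self-adjoint \<open>u\<close> as a difference of two such products, and a general
  \<open>x\<close> splits into real and imaginary parts.\<close>

lemma conditional_expectation_star:
  assumes "conditional_expectation A B E" "cstar_subalgebra A" "1 \<in> A" "x \<in> A"
  shows "E (star x) = star (E x)"
proof -
  note cl = cstar_subalgebra_closed[OF assms(2)] cstar_subalgebra_diff[OF assms(2)]
  have add: "E (u + v) = E u + E v" if "u \<in> A" "v \<in> A" for u v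
    using assms(1) that by (auto simp: conditional_expectation_def)
  have scale: "E (c *\<^sub>C u) = c *\<^sub>C E u" if "u \<in> A" for u c
    using assms(1) that by (auto simp: conditional_expectation_def)
  have pos: "star (E (star u * u)) = E (star u * u)" if "u \<in> A" for u
  proof -
    have "E (star u * u) \<in> positive_elements B"
      using assms(1) that unfolding conditional_expectation_def positive_elements_def by blast
    thus ?thesis by (auto simp: positive_elements_def star_mult star_star)
  qed
  have sa: "star (E u) = E u" if u: "u \<in> A" "star u = u" for u
  proof -
    let ?p = "star (1 + u) * (1 + u)" and ?q = "star (1 - u) * (1 - u)"
    have "4 *\<^sub>C u = complex_of_real 4 *\<^sub>C u" by simp
    hence "4 *\<^sub>C u = (u + u) + (u + u)"
      unfolding scaleC_of_real by (simp flip: scaleR_2)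
    hence "?p = ?q + 4 *\<^sub>C u"
      by (simp add: star_add star_diff u algebra_simps)
    moreover have A: "?q \<in> A" "?p \<in> A" "4 *\<^sub>C u \<in> A"
      using u assms(3) by (auto intro!: cl)
    ultimately have "E ?p = E ?q + 4 *\<^sub>C E u" using u by (simp add: add scale)
    moreover have "star (E ?p) = E ?p" "star (E ?q) = E ?q"
      using u assms(3) by (auto intro!: pos cl)
    ultimately have "4 *\<^sub>C star (E u) = 4 *\<^sub>C E u"
      by (metis add_left_cancel complex_cnj_numeral star_add star_scaleC)
    hence "(1/4) *\<^sub>C 4 *\<^sub>C star (E u) = (1/4) *\<^sub>C 4 *\<^sub>C E u" by simp
    thus ?thesis unfolding scaleC_scaleC by simp
  qed
  define a b where "a = (1/2) *\<^sub>C (x + star x)" and "b = (- \<i>/2) *\<^sub>C (x - star x)"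
  have A: "a \<in> A" "b \<in> A" unfolding a_def b_def using assms(4) by (auto intro!: cl)
  have s: "star a = a" "star b = b"
    by (simp_all add: a_def b_def star_scaleC star_add star_diff star_star add.commute
        scaleC_diff_right scaleC_minus_left)
  have half: "(1/2) *\<^sub>C y + (1/2) *\<^sub>C y = y" for y :: 'a
    by (simp flip: scaleC_add_left)
  have x: "x = a + \<i> *\<^sub>C b" "star x = a + (- \<i>) *\<^sub>C b"
    using half by (simp_all add: a_def b_def scaleC_scaleC scaleC_add_right scaleC_diff_right
        scaleC_minus_left algebra_simps)
  show ?thesis
    unfolding x(2) by (subst x(1))
      (use A in \<open>simp add: add scale cl sa[OF A(1) s(1)] sa[OF A(2) s(2)] star_add star_scaleC\<close>)
qed

section \<open>Expansions in a fixed quasi-basis\<close>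

locale irreducible_finite_index =
  fixes A B :: "'a::unital_cstar_algebra set" and E :: "'a \<Rightarrow> 'a"
    and n :: nat and l :: "nat \<Rightarrow> 'a"
  assumes irr: "irreducible_inclusion B A"
    and ce: "conditional_expectation A B E"
    and qb: "quasi_basis A E n l"
begin

lemma A_sub: "cstar_subalgebra A" and B_sub: "cstar_subalgebra B"
  and one_B: "1 \<in> B" and B_A: "b \<in> B \<Longrightarrow> b \<in> A" and one_A: "1 \<in> A"
  using irr by (auto simp: irreducible_inclusion_def unital_inclusion_def)

lemmas A_closed = cstar_subalgebra_closed[OF A_sub] cstar_subalgebra_diff[OF A_sub]
  cstar_subalgebra_sum[OF A_sub]
lemmas B_closed = cstar_subalgebra_closed[OF B_sub] cstar_subalgebra_diff[OF B_sub]
  cstar_subalgebra_sum[OF B_sub]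

lemma commutant_scalar:
  assumes "x \<in> A" "\<And>b. b \<in> B \<Longrightarrow> b * x = x * b"
  obtains c where "x = c *\<^sub>C 1"
proof -
  have "x \<in> relative_commutant B A" using assms by (auto simp: relative_commutant_def)
  thus ?thesis using irr that by (auto simp: irreducible_inclusion_def)
qed

lemma l_A [simp]: "i < n \<Longrightarrow> l i \<in> A"
  using qb unfolding quasi_basis_def by blast

lemma E_B: "x \<in> A \<Longrightarrow> E x \<in> B"
  and E_id: "b \<in> B \<Longrightarrow> E b = b"
  and E_add: "x \<in> A \<Longrightarrow> y \<in> A \<Longrightarrow> E (x + y) = E x + E y"
  and E_norm: "x \<in> A \<Longrightarrow> norm (E x) \<le> norm x"
  using ce by (auto simp: conditional_expectation_def)

lemma E_A: "x \<in> A \<Longrightarrow> E x \<in> A"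
  using E_B B_A by blast

lemma E_left: "b \<in> B \<Longrightarrow> x \<in> A \<Longrightarrow> E (b * x) = b * E x"
  and E_right: "b \<in> B \<Longrightarrow> x \<in> A \<Longrightarrow> E (x * b) = E x * b"
proof -
  have "E (b * x * c) = b * E x * c" if "b \<in> B" "x \<in> A" "c \<in> B" for b x c
    using ce that by (auto simp: conditional_expectation_def)
  from this[of b x 1] this[of 1 x b] show
    "b \<in> B \<Longrightarrow> x \<in> A \<Longrightarrow> E (b * x) = b * E x" "b \<in> B \<Longrightarrow> x \<in> A \<Longrightarrow> E (x * b) = E x * b"
    using one_B by auto
qed

lemma E_zero: "E 0 = 0"
  by (simp add: E_id B_closed)

lemma E_sum: "(\<And>i. i \<in> I \<Longrightarrow> f i \<in> A) \<Longrightarrow> E (sum f I) = (\<Sum>i\<in>I. E (f i))"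
  by (induction I rule: infinite_finite_induct) (auto simp: E_add E_zero A_closed)

lemma E_star: "x \<in> A \<Longrightarrow> E (star x) = star (E x)"
  using conditional_expectation_star[OF ce A_sub one_A] .

lemma star_E_star_mult: "x \<in> A \<Longrightarrow> y \<in> A \<Longrightarrow> star (E (star x * y)) = E (star y * x)"
  by (simp flip: E_star add: A_closed star_mult star_star)

lemma expand_left: "x \<in> A \<Longrightarrow> (\<Sum>i<n. E (x * l i) * star (l i)) = x"
  using qb unfolding quasi_basis_def by metis

lemma expand_right:
  assumes "x \<in> A"
  shows "(\<Sum>i<n. l i * E (star (l i) * x)) = x"
proof -
  have "star (\<Sum>i<n. E (star x * l i) * star (l i)) = star (star x)"
    using expand_left[of "star x"] assms by (simp add: A_closed)
  thus ?thesis using assms by (simp add: star_sum star_mult star_star star_E_star_mult)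
qed

section \<open>Bimodule maps\<close>

text \<open>Complex homogeneity is implied, because \<open>B\<close> contains the scalar multiples
  of 1.\<close>

definition bimod :: "('a \<Rightarrow> 'a) \<Rightarrow> bool" where
  "bimod T \<longleftrightarrow> (\<forall>x\<in>A. T x \<in> A) \<and> (\<forall>x\<in>A. \<forall>y\<in>A. T (x + y) = T x + T y) \<and>
     (\<forall>b\<in>B. \<forall>x\<in>A. T (b * x) = b * T x) \<and> (\<forall>b\<in>B. \<forall>x\<in>A. T (x * b) = T x * b)"

lemma bimodD:
  assumes "bimod T"
  shows "x \<in> A \<Longrightarrow> T x \<in> A" "x \<in> A \<Longrightarrow> y \<in> A \<Longrightarrow> T (x + y) = T x + T y"
    "b \<in> B \<Longrightarrow> x \<in> A \<Longrightarrow> T (b * x) = b * T x" "b \<in> B \<Longrightarrow> x \<in> A \<Longrightarrow> T (x * b) = T x * b"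
  using assms by (auto simp: bimod_def)

lemma bimod_zero: "bimod T \<Longrightarrow> T 0 = 0"
  using bimodD(3)[of T 0 0] by (simp add: A_closed B_closed)

lemma bimod_sum:
  assumes T: "bimod T" and "\<And>i. i \<in> I \<Longrightarrow> f i \<in> A"
  shows "T (sum f I) = (\<Sum>i\<in>I. T (f i))"
  using assms(2) by (induction I rule: infinite_finite_induct)
    (auto simp: bimodD(2)[OF T] bimod_zero[OF T] A_closed)

lemma bimod_expand:
  assumes "bimod T" "y \<in> A"
  shows "T y = (\<Sum>k<n. T (l k) * E (star (l k) * y))"
proof -
  have "T y = T (\<Sum>k<n. l k * E (star (l k) * y))" by (simp add: expand_right assms)
  also have "\<dots> = (\<Sum>k<n. T (l k * E (star (l k) * y)))"
    using assms by (intro bimod_sum) (auto intro!: A_closed E_A)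
  also have "\<dots> = (\<Sum>k<n. T (l k) * E (star (l k) * y))"
    using assms(2) by (intro sum.cong refl bimodD(4)[OF assms(1)]) (auto intro!: A_closed E_B)
  finally show ?thesis .
qed

text \<open>The adjoint of the expansion of \<open>S (star b * x)\<close>. Read from left to right
  it moves \<open>b\<close> across a sum over the quasi-basis, which is how left
  \<open>B\<close>-linearity enters below.\<close>

lemma bimod_expand_star:
  assumes "bimod S" "b \<in> B" "x \<in> A"
  shows "(\<Sum>k<n. E (star x * (b * l k)) * star (S (l k))) = star (S x) * b"
proof -
  have b: "star b \<in> B" "star b \<in> A" using assms B_closed B_A by auto
  have "star (S x) * b = star (S (star b * x))"
    using assms b by (simp add: bimodD star_mult star_star)
  also have "\<dots> = star (\<Sum>k<n. S (l k) * E (star (l k) * (star b * x)))"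
    using assms b by (subst bimod_expand) (auto simp: A_closed)
  also have "\<dots> = (\<Sum>k<n. star (E (star (l k) * (star b * x))) * star (S (l k)))"
    by (simp add: star_sum star_mult)
  also have "\<dots> = (\<Sum>k<n. E (star x * (b * l k)) * star (S (l k)))"
    using assms b by (intro sum.cong refl)
      (simp add: star_E_star_mult A_closed star_mult star_star mult.assoc)
  finally show ?thesis ..
qed

section \<open>The inner product of bimodule maps\<close>

definition ip :: "('a \<Rightarrow> 'a) \<Rightarrow> ('a \<Rightarrow> 'a) \<Rightarrow> 'a" where
  "ip S T = (\<Sum>k<n. T (l k) * star (S (l k)))"

text \<open>Expanding \<open>T (b * l k)\<close> in the quasi-basis and resumming over
  \<open>k\<close> with \<open>bimod_expand_star\<close> moves \<open>b\<close> from the left of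
  \<open>ip S T\<close> to its right. So \<open>ip S T\<close> lies in the relative commutant, which
  is where irreducibility is used.\<close>

lemma ip_scalar:
  assumes "bimod S" "bimod T"
  obtains c where "ip S T = c *\<^sub>C 1"
proof -
  have ipA: "ip S T \<in> A"
    unfolding ip_def using assms by (intro A_closed) (simp_all add: bimodD)
  have comm: "b * ip S T = ip S T * b" if b: "b \<in> B" for b
  proof -
    have bA: "b * l k \<in> A" if "k < n" for k using b that by (simp add: A_closed B_A)
    have "b * ip S T = (\<Sum>k<n. T (b * l k) * star (S (l k)))"
      unfolding ip_def sum_distrib_left
      using assms b by (intro sum.cong refl) (simp add: bimodD mult.assoc)
    also have "\<dots> = (\<Sum>k<n. \<Sum>j<n. T (l j) * (E (star (l j) * (b * l k)) * star (S (l k))))"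
      using bA assms by (intro sum.cong refl, subst bimod_expand)
        (simp_all add: sum_distrib_right mult.assoc)
    also have "\<dots> = (\<Sum>j<n. T (l j) * (\<Sum>k<n. E (star (l j) * (b * l k)) * star (S (l k))))"
      by (subst sum.swap) (simp add: sum_distrib_left)
    also have "\<dots> = ip S T * b"
      using assms b by (simp add: bimod_expand_star ip_def sum_distrib_right mult.assoc)
    finally show "b * ip S T = ip S T * b" .
  qed
  show ?thesis using commutant_scalar[OF ipA comm] that by blast
qed

lemma pos_ip: "pos (ip T T)"
  unfolding ip_def by (intro pos_sum pos_mult_star)

text \<open>A single positive summand has norm at most that of the sum. In particular
  \<open>ip T T = 0\<close> makes \<open>T\<close> vanish on the quasi-basis.\<close>

lemma norm_le_ip:
  assumes "k < n"
  shows "(norm (T (l k)))\<^sup>2 \<le> norm (ip T T)"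
proof -
  have "norm (T (l k) * star (T (l k))) \<le> norm (ip T T)"
    unfolding ip_def
    by (rule norm_le_norm_sum_pos[where f = "\<lambda>k. T (l k) * star (T (l k))"])
      (use assms in \<open>auto intro: pos_mult_star\<close>)
  thus ?thesis by (simp add: cstar_identity')
qed

section \<open>Adjoints of bimodule maps\<close>

text \<open>For \<open>w k = T (l k)\<close> this is the adjoint of \<open>T\<close> with respect to \<open>E (star x * y)\<close>.\<close>

definition adj :: "(nat \<Rightarrow> 'a) \<Rightarrow> 'a \<Rightarrow> 'a" where
  "adj w y = (\<Sum>k<n. l k * E (star (w k) * y))"

lemma adj_A: "(\<And>k. k < n \<Longrightarrow> w k \<in> A) \<Longrightarrow> y \<in> A \<Longrightarrow> adj w y \<in> A"
  unfolding adj_def by (auto intro!: A_closed E_A)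

text \<open>A Parseval identity: summing \<open>E (star (w k) * l m) * E (star (l m) * w j)\<close>
  over \<open>m\<close> reassembles \<open>w j\<close> from its expansion.\<close>

lemma ip_adj:
  assumes w: "\<And>k. k < n \<Longrightarrow> w k \<in> A"
  shows "ip (adj w) (adj w) = (\<Sum>k<n. \<Sum>j<n. l k * E (star (w k) * w j) * star (l j))"
proof -
  have "ip (adj w) (adj w) = (\<Sum>m<n. \<Sum>k<n. \<Sum>j<n.
      l k * (E (star (w k) * l m) * E (star (l m) * w j)) * star (l j))"
    unfolding ip_def adj_def star_sum sum_product
    by (intro sum.cong refl) (simp add: star_mult star_E_star_mult w mult.assoc)
  also have "\<dots> = (\<Sum>k<n. \<Sum>j<n. \<Sum>m<n.
      l k * (E (star (w k) * l m) * E (star (l m) * w j)) * star (l j))"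
    by (subst sum.swap, rule sum.cong[OF refl], rule sum.swap)
  also have "\<dots> = (\<Sum>k<n. \<Sum>j<n. l k * E (star (w k) * w j) * star (l j))"
  proof (intro sum.cong refl)
    fix k j assume kj: "k \<in> {..<n}" "j \<in> {..<n}"
    have "(\<Sum>m<n. E (star (w k) * l m) * E (star (l m) * w j))
        = (\<Sum>m<n. E (star (w k) * (l m * E (star (l m) * w j))))"
      using kj w by (intro sum.cong refl) (simp add: E_right E_B A_closed mult.assoc[symmetric])
    also have "\<dots> = E (\<Sum>m<n. star (w k) * (l m * E (star (l m) * w j)))"
      using kj w by (intro E_sum[symmetric]) (auto intro!: A_closed E_A)
    also have "\<dots> = E (star (w k) * w j)"
      using kj w by (simp add: sum_distrib_left[symmetric] expand_right)
    finally show "(\<Sum>m<n. l k * (E (star (w k) * l m) * E (star (l m) * w j)) * star (l j))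
        = l k * E (star (w k) * w j) * star (l j)"
      by (simp add: sum_distrib_left[symmetric] sum_distrib_right[symmetric])
  qed
  finally show ?thesis .
qed

text \<open>Additivity and right linearity hold term by term. For left linearity
  \<open>b * l k\<close> is expanded in the quasi-basis and the sum over \<open>k\<close> is
  evaluated by \<open>bimod_expand_star\<close>.\<close>

lemma bimod_adj:
  assumes T: "bimod T"
  shows "bimod (adj (\<lambda>k. T (l k)))"
  unfolding bimod_def
proof (intro conjI ballI)
  have TA: "T (l k) \<in> A" if "k < n" for k using T that by (simp add: bimodD)
  fix x assume x: "x \<in> A"
  show "adj (\<lambda>k. T (l k)) x \<in> A" using x TA by (intro adj_A)
  show "adj (\<lambda>k. T (l k)) (x + y) = adj (\<lambda>k. T (l k)) x + adj (\<lambda>k. T (l k)) y" if "y \<in> A" for y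
    unfolding adj_def sum.distrib[symmetric] using x that TA
    by (intro sum.cong refl) (simp add: distrib_left E_add A_closed)
  fix b assume b: "b \<in> B"
  show "adj (\<lambda>k. T (l k)) (x * b) = adj (\<lambda>k. T (l k)) x * b"
    unfolding adj_def sum_distrib_right using x b TA
    by (intro sum.cong refl) (simp add: mult.assoc[symmetric] E_right A_closed)
  have bA: "b * l k \<in> A" if "k < n" for k using b that by (simp add: A_closed B_A)
  have "b * adj (\<lambda>k. T (l k)) x = (\<Sum>k<n. (b * l k) * E (star (T (l k)) * x))"
    unfolding adj_def sum_distrib_left by (simp add: mult.assoc)
  also have "\<dots> = (\<Sum>k<n. (\<Sum>m<n. l m * E (star (l m) * (b * l k))) * E (star (T (l k)) * x))"
    using bA by (intro sum.cong refl) (simp add: expand_right)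
  also have "\<dots> = (\<Sum>m<n. l m * (\<Sum>k<n. E (star (l m) * (b * l k)) * E (star (T (l k)) * x)))"
    unfolding sum_distrib_right sum_distrib_left by (subst sum.swap) (simp add: mult.assoc)
  also have "\<dots> = (\<Sum>m<n. l m * E (star (T (l m)) * (b * x)))"
  proof (intro sum.cong refl arg_cong[where f = "\<lambda>y. l _ * y"])
    fix m assume m: "m \<in> {..<n}"
    have "(\<Sum>k<n. E (star (l m) * (b * l k)) * E (star (T (l k)) * x))
        = (\<Sum>k<n. E (E (star (l m) * (b * l k)) * star (T (l k)) * x))"
      using m TA bA x by (intro sum.cong refl) (simp add: mult.assoc E_left E_B A_closed)
    also have "\<dots> = E (\<Sum>k<n. E (star (l m) * (b * l k)) * star (T (l k)) * x)"
      using m TA B_A[OF b] x by (intro E_sum[symmetric]) (auto intro!: A_closed E_A)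
    also have "\<dots> = E (star (T (l m)) * b * x)"
      using m by (simp add: sum_distrib_right[symmetric] bimod_expand_star[OF T b])
    finally show "(\<Sum>k<n. E (star (l m) * (b * l k)) * E (star (T (l k)) * x))
        = E (star (T (l m)) * (b * x))" by (simp add: mult.assoc)
  qed
  finally show "adj (\<lambda>k. T (l k)) (b * x) = b * adj (\<lambda>k. T (l k)) x"
    by (simp add: adj_def)
qed

text \<open>The adjoint relation \<open>E (star (adj (\<lambda>k. T (l k)) (l m)) * y) = E (star (l
  m) * T y)\<close> turns the double adjoint into the expansion of \<open>T y\<close>.\<close>

lemma adj_adj:
  assumes T: "bimod T" and y: "y \<in> A"
  shows "adj (\<lambda>m. adj (\<lambda>k. T (l k)) (l m)) y = T y"
proof -
  have TA: "T (l k) \<in> A" if "k < n" for k using T that by (simp add: bimodD)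
  have "E (star (adj (\<lambda>k. T (l k)) (l m)) * y) = E (star (l m) * T y)" if m: "m < n" for m
  proof -
    have "star (adj (\<lambda>k. T (l k)) (l m)) * y
        = (\<Sum>k<n. E (star (l m) * T (l k)) * (star (l k) * y))"
      unfolding adj_def star_sum sum_distrib_right using TA m
      by (intro sum.cong refl) (simp add: star_mult star_E_star_mult mult.assoc)
    hence "E (star (adj (\<lambda>k. T (l k)) (l m)) * y)
        = (\<Sum>k<n. E (E (star (l m) * T (l k)) * (star (l k) * y)))"
      using TA m y by (simp only:) (intro E_sum; auto intro!: A_closed E_A)
    also have "\<dots> = (\<Sum>k<n. E (star (l m) * (T (l k) * E (star (l k) * y))))"
    proof (intro sum.cong refl)
      fix k assume k: "k \<in> {..<n}"
      have "E (E (star (l m) * T (l k)) * (star (l k) * y))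
          = E (star (l m) * T (l k)) * E (star (l k) * y)"
        using TA m y k by (simp add: E_left E_B A_closed)
      also have "\<dots> = E (star (l m) * (T (l k) * E (star (l k) * y)))"
        using TA m y k by (simp add: E_right E_B A_closed mult.assoc[symmetric])
      finally show "E (E (star (l m) * T (l k)) * (star (l k) * y))
          = E (star (l m) * (T (l k) * E (star (l k) * y)))" .
    qed
    also have "\<dots> = E (\<Sum>k<n. star (l m) * (T (l k) * E (star (l k) * y)))"
      using TA m y by (intro E_sum[symmetric]) (auto intro!: A_closed E_A)
    also have "\<dots> = E (star (l m) * T y)"
      using bimod_expand[OF T y] by (simp add: sum_distrib_left)
    finally show ?thesis .
  qed
  thus ?thesis
    unfolding adj_def[of "\<lambda>m. adj (\<lambda>k. T (l k)) (l m)"]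
    using expand_right[of "T y"] T y by (simp add: bimodD)
qed

text \<open>\<open>L\<close> and \<open>L2\<close> measure the size of the quasi-basis;
  \<open>L2\<close> bounds the norm of the index \<open>\<Sum>k<n. l k * star (l k)\<close>.\<close>

definition L :: real where "L = (\<Sum>k<n. norm (l k))"
definition L2 :: real where "L2 = (\<Sum>k<n. (norm (l k))\<^sup>2)"

lemma L_nonneg: "L \<ge> 0" by (simp add: L_def sum_nonneg)
lemma L2_nonneg: "L2 \<ge> 0" by (simp add: L2_def sum_nonneg)

text \<open>The map \<open>T\<close> is recovered from its adjoint by \<open>adj_adj\<close>, and
  the values of the adjoint on the quasi-basis are bounded by \<open>norm_le_ip\<close>.
  Orthonormality normalises the maps while the index bounds their adjoints; this estimate links the
  two.\<close>

lemma norm_ip_le_adj: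
  assumes T: "bimod T"
  shows "norm (ip T T)
    \<le> L\<^sup>2 * L2 * norm (ip (adj (\<lambda>k. T (l k))) (adj (\<lambda>k. T (l k))))"
proof -
  let ?T' = "adj (\<lambda>k. T (l k))"
  let ?s = "norm (ip ?T' ?T')"
  have T'A: "?T' (l m) \<in> A" if "m < n" for m
    using bimodD(1)[OF T] that by (intro adj_A) auto
  have T': "norm (?T' (l m)) \<le> sqrt ?s" if "m < n" for m
    using norm_le_ip[OF that, of ?T'] by (simp add: real_le_rsqrt)
  have Tk: "norm (T (l k)) \<le> L * sqrt ?s * norm (l k)" if k: "k < n" for k
  proof -
    have "norm (T (l k)) = norm (\<Sum>m<n. l m * E (star (?T' (l m)) * l k))"
      using adj_adj[OF T, of "l k"] k by (simp add: adj_def)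
    also have "\<dots> \<le> (\<Sum>m<n. norm (l m) * (sqrt ?s * norm (l k)))"
    proof (rule sum_norm_le)
      fix m assume m: "m \<in> {..<n}"
      have "norm (E (star (?T' (l m)) * l k)) \<le> norm (star (?T' (l m)) * l k)"
        using m k T'A by (intro E_norm) (auto intro!: A_closed)
      also have "\<dots> \<le> norm (?T' (l m)) * norm (l k)"
        using norm_mult_ineq[of "star (?T' (l m))" "l k"] by simp
      also have "\<dots> \<le> sqrt ?s * norm (l k)"
        using T' m by (intro mult_right_mono) auto
      finally have "norm (l m) * norm (E (star (?T' (l m)) * l k))
          \<le> norm (l m) * (sqrt ?s * norm (l k))" by (intro mult_left_mono) auto
      thus "norm (l m * E (star (?T' (l m)) * l k)) \<le> norm (l m) * (sqrt ?s * norm (l k))"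
        using norm_mult_ineq order_trans by blast
    qed
    also have "\<dots> = L * sqrt ?s * norm (l k)"
      by (simp add: L_def sum_distrib_right mult.assoc)
    finally show ?thesis .
  qed
  have "norm (ip T T) = norm (\<Sum>k<n. T (l k) * star (T (l k)))" by (simp add: ip_def)
  also have "\<dots> \<le> (\<Sum>k<n. (L * sqrt ?s * norm (l k))\<^sup>2)"
  proof (rule sum_norm_le)
    fix k assume "k \<in> {..<n}"
    thus "norm (T (l k) * star (T (l k))) \<le> (L * sqrt ?s * norm (l k))\<^sup>2"
      using Tk[of k] by (simp add: cstar_identity' power_mono)
  qed
  also have "\<dots> = L\<^sup>2 * L2 * ?s"
    by (simp add: power_mult_distrib L2_def sum_distrib_left sum_distrib_right mult_ac)
  finally show ?thesis .
qed

end

text \<open>Induction on the number of coordinates: finitely many discs of radius \<open>e/2\<close>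
  cover the disc of radius \<open>K m\<close>, and by the pigeonhole principle infinitely many
  members have their new coordinate in a common one.\<close>

lemma infinite_close_subset:
  fixes g :: "'i \<Rightarrow> nat \<Rightarrow> complex"
  assumes "infinite I" and bd: "\<And>x i. x \<in> I \<Longrightarrow> i < m \<Longrightarrow> norm (g x i) \<le> K i" and "e > 0"
  shows "\<exists>J\<subseteq>I. infinite J \<and> (\<forall>x\<in>J. \<forall>y\<in>J. \<forall>i<m. norm (g x i - g y i) < e)"
  using bd
proof (induction m)
  case 0
  thus ?case using assms(1) by blast
next
  case (Suc m)
  then obtain J where J: "J \<subseteq> I" "infinite J"
    "\<And>x y i. x \<in> J \<Longrightarrow> y \<in> J \<Longrightarrow> i < m \<Longrightarrow> norm (g x i - g y i) < e"
    by (metis less_Suc_eq)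
  obtain k :: "complex set" where k: "finite k" "cball 0 (K m) \<subseteq> (\<Union>c\<in>k. ball c (e/2))"
    using compact_cball[of "0::complex" "K m"] half_gt_zero[OF assms(3)]
    unfolding compact_eq_totally_bounded by blast
  have "\<exists>c\<in>k. g x m \<in> ball c (e/2)" if "x \<in> J" for x
  proof -
    have "g x m \<in> cball 0 (K m)" using that J(1) Suc.prems by (auto simp: subset_iff)
    thus ?thesis using k(2) by blast
  qed
  then obtain h where h: "\<And>x. x \<in> J \<Longrightarrow> h x \<in> k \<and> g x m \<in> ball (h x) (e/2)" by metis
  have "finite (h ` J)" using k(1) h by (meson finite_subset image_subsetI)
  then obtain x0 where x0: "x0 \<in> J" "infinite {x\<in>J. h x = h x0}"
    using pigeonhole_infinite[OF J(2)] by blast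
  have "norm (g x i - g y i) < e"
    if "x \<in> J" "h x = h x0" "y \<in> J" "h y = h x0" "i < Suc m" for x y i
  proof (cases "i = m")
    case True
    have "dist (h x0) (g x m) < e/2" "dist (h x0) (g y m) < e/2" using h that by force+
    thus ?thesis using True dist_triangle3[of "g x m" "g y m" "h x0"] by (simp add: dist_norm)
  qed (use J(3) that in auto)
  thus ?case using x0(2) J(1)
    by (intro exI[of _ "{x\<in>J. h x = h x0}"]) auto
qed

section \<open>Orthonormal families and finite dimension\<close>

context irreducible_finite_index
begin

definition orthonormal :: "nat \<Rightarrow> (nat \<Rightarrow> 'a \<Rightarrow> 'a) \<Rightarrow> bool" where
  "orthonormal m U \<longleftrightarrow> (\<forall>i<m. bimod (U i)) \<and>
     (\<forall>i<m. \<forall>j<m. ip (U i) (U j) = (if i = j then 1 else 0))"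

text \<open>The rows \<open>v i k = U i (l k)\<close> are orthonormal over \<open>A\<close>, so \<open>P k j = (\<Sum>i. star (v i k) * v i j)\<close>
  and \<open>Q = 1 - P\<close> are projections in the matrices over \<open>A\<close>. Hence the inner products of the
  adjoints of the \<open>U i\<close> with themselves add up to at most the index \<open>\<Sum>k. l k * star (l k)\<close>.\<close>

lemma orthonormal_bound:
  assumes "orthonormal m U"
  shows "real m \<le> L\<^sup>2 * L2 * L2"
proof -
  define v where "v i k = U i (l k)" for i k
  have bU: "bimod (U i)" if "i < m" for i using assms that by (auto simp: orthonormal_def)
  have vA: "v i k \<in> A" if "i < m" "k < n" for i k
    using bU that by (simp add: v_def bimodD)
  have on: "(\<Sum>r<n. v i r * star (v j r)) = (if i = j then 1 else 0)" if "i < m" "j < m" for i j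
    using assms that by (auto simp: orthonormal_def ip_def v_def)
  define P where "P k j = (\<Sum>i<m. star (v i k) * v i j)" for k j
  define Q where "Q k j = (if k = j then 1 else 0) - P k j" for k j
  have PA: "P k j \<in> A" if "k < n" "j < n" for k j
    unfolding P_def using vA that by (auto intro!: A_closed)
  have QA: "Q k j \<in> A" if "k < n" "j < n" for k j
    unfolding Q_def using PA that one_A by (intro A_closed(6)) (simp_all add: A_closed(1))
  have sP: "star (P r k) = P k r" for r k
    by (simp add: P_def star_sum star_mult star_star)
  have sQ: "star (Q r k) = Q k r" for r k
    by (auto simp: Q_def star_diff sP)
  have PP: "(\<Sum>r<n. P k r * P r j) = P k j" for k j
  proof -
    have "(\<Sum>r<n. P k r * P r j)
        = (\<Sum>r<n. \<Sum>i<m. \<Sum>i'<m. star (v i k) * (v i r * star (v i' r)) * v i' j)"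
      unfolding P_def sum_product by (simp add: mult.assoc)
    also have "\<dots> = (\<Sum>i<m. \<Sum>i'<m. \<Sum>r<n. star (v i k) * (v i r * star (v i' r)) * v i' j)"
      by (subst sum.swap, rule sum.cong[OF refl], rule sum.swap)
    also have "\<dots> = (\<Sum>i<m. \<Sum>i'<m. star (v i k) * (if i = i' then 1 else 0) * v i' j)"
      by (intro sum.cong refl) (simp add: on sum_distrib_left[symmetric] sum_distrib_right[symmetric])
    also have "\<dots> = (\<Sum>i<m. \<Sum>i'<m. if i = i' then star (v i k) * v i' j else 0)"
      by (intro sum.cong refl) simp
    finally show ?thesis by (simp add: P_def)
  qed
  have QQ: "(\<Sum>r<n. star (Q r k) * Q r j) = Q k j" if "k < n" "j < n" for k j
  proof -
    have "(\<Sum>r<n. star (Q r k) * Q r j) = (\<Sum>r<n. Q k r * Q r j)" by (simp add: sQ)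
    \<comment> \<open>Written with Kronecker deltas, the product is
      \<open>1 - P - P + P * P\<close>, and \<open>P\<close> is idempotent.\<close>
    also have "\<dots> = (\<Sum>r<n. (if r = k then (if k = j then 1 else 0) else 0)
        - (if r = k then P k j else 0) - (if r = j then P k j else 0) + P k r * P r j)"
      by (intro sum.cong refl) (auto simp: Q_def algebra_simps)
    also have "\<dots> = Q k j"
      using that by (simp add: sum.distrib sum_subtractf PP Q_def)
    finally show ?thesis .
  qed
  let ?U' = "\<lambda>i. adj (\<lambda>k. U i (l k))"
  have "\<exists>s. ip (?U' i) (?U' i) = s *\<^sub>C 1" if "i < m" for i
    using ip_scalar[of "?U' i" "?U' i"] bimod_adj[OF bU[OF that]] by blast
  then obtain s where s: "\<And>i. i < m \<Longrightarrow> ip (?U' i) (?U' i) = s i *\<^sub>C 1" by metis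
  have s_of_real: "s i = complex_of_real (cmod (s i))" if "i < m" for i
    using pos_ip[of "?U' i"] unfolding s[OF that] by (rule pos_scaleC_one_imp)
  have s_ge: "1 \<le> L\<^sup>2 * L2 * cmod (s i)" if i: "i < m" for i
  proof -
    have "ip (U i) (U i) = 1" using assms i by (auto simp: orthonormal_def)
    thus ?thesis using norm_ip_le_adj[OF bU[OF i]] s[OF i] by (simp add: norm_scaleC)
  qed
  have total: "(\<Sum>i<m. ip (?U' i) (?U' i)) + (\<Sum>r<n. ip (adj (Q r)) (adj (Q r)))
      = (\<Sum>k<n. l k * star (l k))"
  proof -
    have 1: "(\<Sum>i<m. ip (?U' i) (?U' i)) = (\<Sum>k<n. \<Sum>j<n. l k * E (P k j) * star (l j))"
    proof -
      have "(\<Sum>i<m. ip (?U' i) (?U' i))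
          = (\<Sum>i<m. \<Sum>k<n. \<Sum>j<n. l k * E (star (v i k) * v i j) * star (l j))"
        using vA by (intro sum.cong refl) (subst ip_adj, auto simp: v_def)
      also have "\<dots> = (\<Sum>k<n. \<Sum>j<n. \<Sum>i<m. l k * E (star (v i k) * v i j) * star (l j))"
        by (subst sum.swap, rule sum.cong[OF refl], rule sum.swap)
      also have "\<dots> = (\<Sum>k<n. \<Sum>j<n. l k * E (P k j) * star (l j))"
        unfolding P_def using vA by (intro sum.cong refl)
          (subst E_sum, auto intro!: A_closed simp: sum_distrib_left sum_distrib_right)
      finally show ?thesis .
    qed
    have 2: "(\<Sum>r<n. ip (adj (Q r)) (adj (Q r))) = (\<Sum>k<n. \<Sum>j<n. l k * E (Q k j) * star (l j))"
    proof -
      have "(\<Sum>r<n. ip (adj (Q r)) (adj (Q r)))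
          = (\<Sum>r<n. \<Sum>k<n. \<Sum>j<n. l k * E (star (Q r k) * Q r j) * star (l j))"
        using QA by (intro sum.cong refl) (subst ip_adj, auto)
      also have "\<dots> = (\<Sum>k<n. \<Sum>j<n. \<Sum>r<n. l k * E (star (Q r k) * Q r j) * star (l j))"
        by (subst sum.swap, rule sum.cong[OF refl], rule sum.swap)
      also have "\<dots> = (\<Sum>k<n. \<Sum>j<n. l k * E (\<Sum>r<n. star (Q r k) * Q r j) * star (l j))"
        using QA by (intro sum.cong refl)
          (subst E_sum, auto intro!: A_closed simp: sum_distrib_left sum_distrib_right)
      also have "\<dots> = (\<Sum>k<n. \<Sum>j<n. l k * E (Q k j) * star (l j))"
        by (intro sum.cong refl) (simp add: QQ)
      finally show ?thesis .
    qed
    \<comment> \<open>\<open>P\<close> and \<open>Q\<close> add up to the identity matrix, whose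
      entries are fixed by \<open>E\<close>; only the diagonal terms of the double sum
      survive.\<close>
    have "E (P k j) + E (Q k j) = (if k = j then 1 else 0)" if "k < n" "j < n" for k j
    proof -
      have "E (P k j) + E (Q k j) = E (P k j + Q k j)" by (simp add: E_add PA QA that)
      also have "P k j + Q k j = (if k = j then 1 else 0)" by (simp add: Q_def)
      finally show ?thesis using one_B by (simp add: E_id E_zero)
    qed
    hence "(\<Sum>k<n. \<Sum>j<n. l k * (E (P k j) + E (Q k j)) * star (l j))
        = (\<Sum>k<n. \<Sum>j<n. if k = j then l k * star (l j) else 0)"
      by (intro sum.cong refl) simp
    thus ?thesis
      unfolding 1 2 sum.distrib[symmetric]
      by (simp add: distrib_left distrib_right)
  qed
  \<comment> \<open>Each member contributes at least 1 by \<open>s_ge\<close>, while the scalars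
    \<open>s i\<close> add up to at most the norm of the index.\<close>
  have "real m = (\<Sum>i<m. 1)" by simp
  also have "\<dots> \<le> (\<Sum>i<m. L\<^sup>2 * L2 * cmod (s i))" using s_ge by (intro sum_mono) auto
  also have "\<dots> = L\<^sup>2 * L2 * (\<Sum>i<m. cmod (s i))" by (simp add: sum_distrib_left)
  also have "\<dots> \<le> L\<^sup>2 * L2 * L2"
  proof (rule mult_left_mono)
    have "(\<Sum>i<m. ip (?U' i) (?U' i)) = (\<Sum>i<m. complex_of_real (cmod (s i)) *\<^sub>C 1)"
      using s s_of_real by (intro sum.cong) auto
    also have "\<dots> = complex_of_real (\<Sum>i<m. cmod (s i)) *\<^sub>C 1" by (simp add: scaleC_sum_left)
    finally have "norm (\<Sum>i<m. ip (?U' i) (?U' i)) = \<bar>\<Sum>i<m. cmod (s i)\<bar>"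
      by (simp only: norm_scaleC norm_of_real norm_one mult_1_right)
    also have "\<dots> = (\<Sum>i<m. cmod (s i))" by (simp add: sum_nonneg)
    finally have "(\<Sum>i<m. cmod (s i)) = norm (\<Sum>i<m. ip (?U' i) (?U' i))" ..
    also have "\<dots> \<le> norm (\<Sum>k<n. l k * star (l k))"
      unfolding total[symmetric] by (intro norm_le_add_pos pos_sum pos_ip)
    also have "\<dots> \<le> L2"
      unfolding L2_def by (rule sum_norm_le) (simp add: cstar_identity')
    finally show "(\<Sum>i<m. cmod (s i)) \<le> L2" .
    show "0 \<le> L\<^sup>2 * L2" by (simp add: L2_nonneg)
  qed
  finally show ?thesis .
qed

lemma bimod_diff:
  assumes "bimod S" "bimod T"
  shows "bimod (\<lambda>x. S x - T x)"
  unfolding bimod_def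
  by (intro conjI ballI) (simp_all add: bimodD[OF assms(1)] bimodD[OF assms(2)] A_closed algebra_simps)

lemma bimod_scaleC:
  assumes "bimod T"
  shows "bimod (\<lambda>x. c *\<^sub>C T x)"
  unfolding bimod_def
  by (intro conjI ballI)
    (simp_all add: bimodD[OF assms] A_closed scaleC_add_right scaleC_mult_left scaleC_mult_right)

lemma bimod_sum_fun:
  assumes "\<And>i. i \<in> I \<Longrightarrow> bimod (T i)"
  shows "bimod (\<lambda>x. \<Sum>i\<in>I. T i x)"
  unfolding bimod_def
  by (intro conjI ballI)
    (auto simp: bimodD[OF assms] sum.distrib sum_distrib_left sum_distrib_right intro!: A_closed)

text \<open>One Gram-Schmidt step. The residual \<open>R\<close> is orthogonal to every
  \<open>U i\<close>; either \<open>ip R R\<close> vanishes, and with it \<open>R\<close> on the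
  quasi-basis, or \<open>R\<close> can be normalised and appended.\<close>

lemma orthonormal_extend_or_span:
  assumes on: "orthonormal m U" and T: "bimod T"
    and c: "\<And>i. i < m \<Longrightarrow> ip (U i) T = c i *\<^sub>C 1"
  shows "(\<exists>U'. orthonormal (Suc m) U') \<or> (\<forall>k<n. T (l k) = (\<Sum>i<m. c i *\<^sub>C U i (l k)))"
proof -
  have bU: "bimod (U i)" if "i < m" for i using on that by (auto simp: orthonormal_def)
  have onU: "ip (U i) (U j) = (if i = j then 1 else 0)" if "i < m" "j < m" for i j
    using on that by (auto simp: orthonormal_def)
  define R where "R x = T x - (\<Sum>i<m. c i *\<^sub>C U i x)" for x
  have bR: "bimod R"
    unfolding R_def by (intro bimod_diff bimod_sum_fun bimod_scaleC T bU) simp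
  have UR: "ip (U j) R = 0" if j: "j < m" for j
  proof -
    have "ip (U j) R = ip (U j) T - (\<Sum>k<n. \<Sum>i<m. c i *\<^sub>C (U i (l k) * star (U j (l k))))"
      by (simp add: ip_def R_def left_diff_distrib sum_distrib_right scaleC_mult_left sum_subtractf)
    also have "(\<Sum>k<n. \<Sum>i<m. c i *\<^sub>C (U i (l k) * star (U j (l k)))) = (\<Sum>i<m. c i *\<^sub>C ip (U j) (U i))"
      by (subst sum.swap) (simp add: ip_def scaleC_sum_right)
    also have "\<dots> = (\<Sum>i<m. if j = i then c i *\<^sub>C 1 else 0)"
      using j by (intro sum.cong refl) (simp add: onU)
    finally show ?thesis using j c by simp
  qed
  have star_ip: "star (ip S S') = ip S' S" for S S'
    by (simp add: ip_def star_sum star_mult star_star)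
  have RU: "ip R (U j) = 0" if "j < m" for j
    using UR[OF that] star_ip[of "U j" R] by simp
  show ?thesis
  proof (cases "ip R R = 0")
    case True
    have "R (l k) = 0" if "k < n" for k
      using norm_le_ip[OF that, of R] True by simp
    thus ?thesis by (simp add: R_def)
  next
    case False
    obtain s where s: "ip R R = s *\<^sub>C 1" using ip_scalar[OF bR bR] .
    have sr: "s = complex_of_real (cmod s)" using pos_ip[of R] unfolding s by (rule pos_scaleC_one_imp)
    have s0: "cmod s > 0" using False s by auto
    \<comment> \<open>The factor is real, so it passes through both arguments of \<open>ip\<close>
      without conjugation.\<close>
    define a where "a = complex_of_real (1 / sqrt (cmod s))"
    define U' where "U' i = (if i < m then U i else (\<lambda>x. a *\<^sub>C R x))" for i
    have aa: "a * a * s = 1"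
    proof -
      have "a * a * s = complex_of_real (1 / sqrt (cmod s) * (1 / sqrt (cmod s)) * cmod s)"
        unfolding a_def by (subst sr) (simp only: of_real_mult)
      thus ?thesis using s0 by simp
    qed
    have ipl: "ip (\<lambda>x. a *\<^sub>C S x) S' = a *\<^sub>C ip S S'" and ipr: "ip S (\<lambda>x. a *\<^sub>C S' x) = a *\<^sub>C ip S S'" for S S'
      by (simp_all add: ip_def star_scaleC scaleC_mult_left scaleC_mult_right scaleC_sum_right a_def)
    have "orthonormal (Suc m) U'"
      unfolding orthonormal_def
    proof (intro conjI allI impI)
      fix i show "bimod (U' i)" by (simp add: U'_def bU bR bimod_scaleC)
      fix j assume "i < Suc m" "j < Suc m"
      thus "ip (U' i) (U' j) = (if i = j then 1 else 0)"
        by (auto simp: U'_def onU UR RU ipl ipr s scaleC_scaleC aa mult.assoc[symmetric] less_Suc_eq)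
    qed
    thus ?thesis by blast
  qed
qed

text \<open>By \<open>orthonormal_bound\<close> there is an orthonormal family of maximal length,
  and no Gram-Schmidt step can extend it.\<close>

lemma finite_spanning_family:
  "\<exists>(m::nat) U. (\<forall>i<m. bimod (U i)) \<and>
     (\<forall>T c. bimod T \<longrightarrow> (\<forall>i<m. ip (U i) T = c i *\<^sub>C 1) \<longrightarrow>
       (\<forall>k<n. T (l k) = (\<Sum>i<m. c i *\<^sub>C U i (l k))))"
proof -
  define M where "M = {m. \<exists>U. orthonormal m U}"
  have "m \<le> nat \<lceil>L\<^sup>2 * L2 * L2\<rceil>" if "m \<in> M" for m
  proof -
    have "real m \<le> L\<^sup>2 * L2 * L2" using that orthonormal_bound by (auto simp: M_def)
    thus ?thesis by linarith
  qed
  hence fin: "finite M" using finite_nat_set_iff_bounded_le by blast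
  have "0 \<in> M" by (auto simp: M_def orthonormal_def)
  define m where "m = Max M"
  have "m \<in> M" using fin \<open>0 \<in> M\<close> unfolding m_def by (intro Max_in) auto
  then obtain U where U: "orthonormal m U" by (auto simp: M_def)
  have "Suc m \<notin> M" using Max_ge[OF fin, of "Suc m"] by (auto simp: m_def)
  hence no: "\<not> (\<exists>U'. orthonormal (Suc m) U')" by (simp add: M_def)
  have "\<forall>k<n. T (l k) = (\<Sum>i<m. c i *\<^sub>C U i (l k))"
    if "bimod T" "\<forall>i<m. ip (U i) T = c i *\<^sub>C 1" for T c
    using orthonormal_extend_or_span[OF U that(1), of c] that(2) no by blast
  moreover have "\<forall>i<m. bimod (U i)" using U by (simp add: orthonormal_def)
  ultimately show ?thesis by blast
qed

section \<open>Intermediate subalgebras\<close>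

definition intermediate :: "'a set \<Rightarrow> ('a \<Rightarrow> 'a) \<Rightarrow> bool" where
  "intermediate C F \<longleftrightarrow> cstar_subalgebra C \<and> B \<subseteq> C \<and> C \<subseteq> A \<and>
     conditional_expectation A C F \<and> (\<forall>x\<in>A. E (F x) = E x)"

lemma IMS_iff: "C \<in> IMS B A E \<longleftrightarrow> (\<exists>F. intermediate C F)"
  by (auto simp: IMS_def intermediate_def)

lemma intermediateD:
  assumes "intermediate C F"
  shows "cstar_subalgebra C" "b \<in> B \<Longrightarrow> b \<in> C" "c \<in> C \<Longrightarrow> c \<in> A"
    "x \<in> A \<Longrightarrow> F x \<in> C" "x \<in> A \<Longrightarrow> F x \<in> A" "c \<in> C \<Longrightarrow> F c = c"
    "x \<in> A \<Longrightarrow> y \<in> A \<Longrightarrow> F (x + y) = F x + F y"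
    "x \<in> A \<Longrightarrow> norm (F x) \<le> norm x" "x \<in> A \<Longrightarrow> E (F x) = E x"
    "x \<in> A \<Longrightarrow> F (star x) = star (F x)"
  using assms conditional_expectation_star[OF _ A_sub one_A, of C F x]
  by (auto simp: intermediate_def conditional_expectation_def)

lemma intermediate_module:
  assumes "intermediate C F" "c \<in> C" "x \<in> A"
  shows "F (c * x) = c * F x" "F (x * c) = F x * c"
proof -
  have "F (c * x * d) = c * F x * d" if "c \<in> C" "x \<in> A" "d \<in> C" for c d
    using assms that by (auto simp: intermediate_def conditional_expectation_def)
  from this[of c 1] this[of 1 c] intermediateD(2)[OF assms(1) one_B] assms(2,3)
  show "F (c * x) = c * F x" "F (x * c) = F x * c" by auto
qed

lemma intermediate_bimod: "intermediate C F \<Longrightarrow> bimod F"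
  unfolding bimod_def
  by (intro conjI ballI)
    (simp_all add: intermediateD(5,7) intermediate_module intermediateD(2))

lemma intermediate_diff:
  assumes "intermediate C F" "x \<in> A" "y \<in> A"
  shows "F (x - y) = F x - F y"
  using intermediateD(7)[OF assms(1), of "x - y" y] assms by (simp add: A_closed)

text \<open>Expectations are contractive, so their coordinates in the spanning family are uniformly
  bounded. Infinitely many bounded coordinate vectors contain two that are close, and closeness of
  coordinates is closeness on the quasi-basis.\<close>

lemma intermediate_close_pair:
  assumes "infinite (IMS B A E)" and "e > 0"
  obtains C F D G where "C \<noteq> D" "intermediate C F" "intermediate D G"
    "\<And>k. k < n \<Longrightarrow> norm (F (l k) - G (l k)) \<le> e"
proof -
  obtain m :: nat and U where bU: "\<And>i. i < m \<Longrightarrow> bimod (U i)" and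
    span: "\<And>T c k. bimod T \<Longrightarrow> (\<And>i. i < m \<Longrightarrow> ip (U i) T = c i *\<^sub>C 1) \<Longrightarrow> k < n \<Longrightarrow>
       T (l k) = (\<Sum>i<m. c i *\<^sub>C U i (l k))"
    using finite_spanning_family by blast
  have "\<exists>F. intermediate C F" if "C \<in> IMS B A E" for C
    using that by (simp add: IMS_iff)
  then obtain F where F: "\<And>C. C \<in> IMS B A E \<Longrightarrow> intermediate C (F C)" by metis
  have "\<exists>c. C \<in> IMS B A E \<longrightarrow> i < m \<longrightarrow> ip (U i) (F C) = c *\<^sub>C 1" for C i
    using ip_scalar[OF bU intermediate_bimod[OF F]] by metis
  then obtain c where c: "\<And>C i. C \<in> IMS B A E \<Longrightarrow> i < m \<Longrightarrow> ip (U i) (F C) = c C i *\<^sub>C 1"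
    by metis
  have bd: "norm (c C i) \<le> (\<Sum>k<n. norm (l k) * norm (U i (l k)))"
    if C: "C \<in> IMS B A E" and i: "i < m" for C i
  proof -
    have "norm (c C i) = norm (ip (U i) (F C))" by (simp add: c[OF C i] norm_scaleC)
    also have "\<dots> \<le> (\<Sum>k<n. norm (l k) * norm (U i (l k)))"
      unfolding ip_def
    proof (rule sum_norm_le)
      fix k assume "k \<in> {..<n}"
      hence "norm (F C (l k)) * norm (U i (l k)) \<le> norm (l k) * norm (U i (l k))"
        using intermediateD(8)[OF F[OF C]] by (intro mult_right_mono) auto
      thus "norm (F C (l k) * star (U i (l k))) \<le> norm (l k) * norm (U i (l k))"
        using norm_mult_ineq[of "F C (l k)" "star (U i (l k))"] by simp
    qed
    finally show ?thesis .
  qed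
  \<comment> \<open>\<open>N\<close> turns closeness of the coordinates into closeness of the
    values; the summand 1 makes it positive.\<close>
  define N where "N = 1 + (\<Sum>k<n. \<Sum>i<m. norm (U i (l k)))"
  have N: "N > 0" unfolding N_def by (intro add_pos_nonneg sum_nonneg) auto
  have "e / N > 0" using N assms(2) by simp
  from infinite_close_subset[where g = c and m = m, OF assms(1) bd this]
  obtain J where J: "J \<subseteq> IMS B A E" "infinite J"
    "\<forall>C\<in>J. \<forall>D\<in>J. \<forall>i<m. norm (c C i - c D i) < e / N" by auto
  obtain C where C: "C \<in> J" using infinite_imp_nonempty[OF J(2)] by auto
  obtain D where D: "D \<in> J" "C \<noteq> D"
    using infinite_imp_nonempty[OF infinite_remove[OF J(2), of C]] by auto
  have CD: "C \<in> IMS B A E" "D \<in> IMS B A E" using C D J(1) by auto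
  show ?thesis
  proof (rule that[OF D(2) F[OF CD(1)] F[OF CD(2)]])
    fix k assume k: "k < n"
    have "F C (l k) - F D (l k) = (\<Sum>i<m. (c C i - c D i) *\<^sub>C U i (l k))"
      using span[OF intermediate_bimod[OF F[OF CD(1)]] c[OF CD(1)] k]
        span[OF intermediate_bimod[OF F[OF CD(2)]] c[OF CD(2)] k]
      by (simp add: scaleC_diff_left sum_subtractf)
    also have "norm \<dots> \<le> (\<Sum>i<m. e / N * norm (U i (l k)))"
    proof (rule sum_norm_le)
      fix i assume "i \<in> {..<m}"
      thus "norm ((c C i - c D i) *\<^sub>C U i (l k)) \<le> e / N * norm (U i (l k))"
        unfolding norm_scaleC using J(3) C D(1) by (intro mult_right_mono) (auto intro: less_imp_le)
    qed
    also have "\<dots> = e / N * (\<Sum>i<m. norm (U i (l k)))" by (simp add: sum_distrib_left)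
    also have "\<dots> \<le> e / N * N"
    proof (rule mult_left_mono)
      have "(\<Sum>i<m. norm (U i (l k))) \<le> (\<Sum>k<n. \<Sum>i<m. norm (U i (l k)))"
        using k by (intro member_le_sum[where f = "\<lambda>k. \<Sum>i<m. norm (U i (l k))"]) (auto intro: sum_nonneg)
      thus "(\<Sum>i<m. norm (U i (l k))) \<le> N" by (simp add: N_def)
    qed (use N assms(2) in auto)
    finally show "norm (F C (l k) - F D (l k)) \<le> e" using N by simp
  qed
qed

section \<open>Rigidity of close intermediate subalgebras\<close>

text \<open>The elements \<open>\<mu> j = F (l j)\<close> form a quasi-basis of \<open>C\<close>.
  For \<open>\<delta> = id - G\<close>, the sum of
  \<open>\<delta> (c * \<mu> j) * star (\<mu> j)\<close> is computed twice: by
  \<open>B\<close>-linearity and by the approximate Leibniz rule. Comparison bounds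
  \<open>\<kappa> *\<^sub>C \<delta> c\<close> by a small multiple of
  \<open>norm (\<delta> c)\<close>, and \<open>\<kappa>\<close> is bounded below, so
  \<open>\<delta> c = 0\<close>.\<close>

lemma intermediate_subset_if_close:
  assumes F: "intermediate C F" and G: "intermediate D G"
    and close: "\<And>k. k < n \<Longrightarrow> norm (F (l k) - G (l k)) \<le> e" and e: "4 * e * L ^ 3 < 1"
  shows "C \<subseteq> D"
proof
  define \<mu> where "\<mu> j = F (l j)" for j
  define \<delta> where "\<delta> x = x - G x" for x
  note FD = intermediateD[OF F] and GD = intermediateD[OF G]
  note C_closed = cstar_subalgebra_closed[OF FD(1)]
  have \<mu>C: "\<mu> j \<in> C" if "j < n" for j using that by (simp add: \<mu>_def FD)
  have \<mu>A: "\<mu> j \<in> A" if "j < n" for j using that by (simp add: \<mu>_def FD)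
  have \<mu>_norm: "norm (\<mu> j) \<le> norm (l j)" if "j < n" for j using that by (simp add: \<mu>_def FD(8))
  have \<delta>A: "\<delta> x \<in> A" if "x \<in> A" for x using that by (simp add: \<delta>_def GD(5) A_closed)
  have bF: "bimod F" and bG: "bimod G" using F G intermediate_bimod by auto
  have b\<delta>F: "bimod (\<lambda>x. \<delta> (F x))"
    unfolding \<delta>_def
    by (rule bimod_diff[OF bF]) (use bF bG FD(5) in \<open>simp add: bimod_def\<close>)
  have exp_left: "(\<Sum>j<n. E (c * \<mu> j) * star (\<mu> j)) = c" if c: "c \<in> C" for c
  proof -
    have cA: "c \<in> A" using c FD by simp
    have "c = F (\<Sum>j<n. E (c * l j) * star (l j))" using c cA by (simp add: expand_left FD)
    also have "\<dots> = (\<Sum>j<n. F (E (c * l j) * star (l j)))"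
      using cA by (intro bimod_sum bF) (auto intro!: A_closed E_A)
    also have "\<dots> = (\<Sum>j<n. E (c * \<mu> j) * star (\<mu> j))"
    proof (intro sum.cong refl)
      fix j assume j: "j \<in> {..<n}"
      have "E (c * l j) = E (F (c * l j))" using j cA by (simp add: FD A_closed)
      also have "\<dots> = E (c * \<mu> j)" using j c by (simp add: intermediate_module[OF F] \<mu>_def)
      finally have "E (c * l j) = E (c * \<mu> j)" .
      moreover have "F (E (c * l j) * star (l j)) = E (c * l j) * star (\<mu> j)"
        using j cA by (simp add: bimodD(3)[OF bF] E_B A_closed FD(10) \<mu>_def)
      ultimately show "F (E (c * l j) * star (l j)) = E (c * \<mu> j) * star (\<mu> j)" by simp
    qed
    finally show ?thesis ..
  qed
  have exp_right: "(\<Sum>j<n. \<mu> j * E (star (\<mu> j) * c)) = c" if c: "c \<in> C" for c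
  proof -
    have "star (\<Sum>j<n. E (star c * \<mu> j) * star (\<mu> j)) = c"
      using c by (simp add: exp_left C_closed star_star)
    thus ?thesis using c by (simp add: star_sum star_mult star_star star_E_star_mult FD(3) \<mu>A)
  qed
  obtain \<kappa> where \<kappa>: "(\<Sum>j<n. \<mu> j * star (\<mu> j)) = \<kappa> *\<^sub>C 1"
    using ip_scalar[OF bF bF] unfolding ip_def \<mu>_def .
  obtain \<eta> where \<eta>: "(\<Sum>j<n. \<delta> (\<mu> j) * star (\<mu> j)) = \<eta> *\<^sub>C 1"
    using ip_scalar[OF bF b\<delta>F] unfolding ip_def \<mu>_def .
  \<comment> \<open>The lower bound comes from expanding 1 in the quasi-basis \<open>\<mu>\<close>
    of \<open>C\<close>.\<close>
  have \<kappa>_ge: "1 \<le> L\<^sup>2 * cmod \<kappa>"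
  proof -
    have \<mu>\<kappa>: "norm (\<mu> j) \<le> sqrt (cmod \<kappa>)" if "j < n" for j
      using norm_le_ip[OF that, of F] \<kappa> by (simp add: ip_def \<mu>_def norm_scaleC real_le_rsqrt)
    have "(1::'a) = (\<Sum>j<n. E (\<mu> j) * star (\<mu> j))"
      using exp_left[of 1] one_B FD(2) by simp
    hence "1 = norm (\<Sum>j<n. E (\<mu> j) * star (\<mu> j))" by (metis norm_one)
    also have "\<dots> \<le> (\<Sum>j<n. norm (l j) * sqrt (cmod \<kappa>))"
    proof (rule sum_norm_le)
      fix j assume j: "j \<in> {..<n}"
      have "norm (E (\<mu> j)) \<le> norm (l j)"
        using j E_norm[OF \<mu>A, of j] \<mu>_norm[of j] by simp
      hence "norm (E (\<mu> j)) * norm (star (\<mu> j)) \<le> norm (l j) * sqrt (cmod \<kappa>)"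
        using j \<mu>\<kappa> by (intro mult_mono) auto
      thus "norm (E (\<mu> j) * star (\<mu> j)) \<le> norm (l j) * sqrt (cmod \<kappa>)"
        using norm_mult_ineq order_trans by blast
    qed
    also have "\<dots> = L * sqrt (cmod \<kappa>)" by (simp add: L_def sum_distrib_right)
    finally have "1 \<le> (L * sqrt (cmod \<kappa>))\<^sup>2" by (simp add: one_le_power)
    thus ?thesis by (simp add: power_mult_distrib)
  qed
  have \<delta>\<mu>: "norm (\<delta> (\<mu> j)) \<le> 2 * e" if j: "j < n" for j
  proof -
    \<comment> \<open>As \<open>G\<close> is idempotent, \<open>\<delta>\<close> annihilates
      \<open>G (l j)\<close>, so it may be applied to the small difference instead.\<close>
    have "\<delta> (\<mu> j) = (F (l j) - G (l j)) - G (F (l j) - G (l j))"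
      using j by (simp add: \<delta>_def \<mu>_def intermediate_diff[OF G] GD FD)
    hence "norm (\<delta> (\<mu> j)) \<le> norm (F (l j) - G (l j)) + norm (G (F (l j) - G (l j)))"
      by (metis norm_triangle_ineq4)
    moreover have "norm (G (F (l j) - G (l j))) \<le> norm (F (l j) - G (l j))"
      using j by (intro GD(8)) (auto simp: A_closed GD FD)
    ultimately show ?thesis using close[OF j] by linarith
  qed
  \<comment> \<open>The mixed term \<open>G (\<delta> a * G b)\<close> vanishes because
    \<open>G (\<delta> a) = 0\<close>; what remains besides the derivation rule is quadratic in
    \<open>\<delta>\<close>.\<close>
  have leibniz: "\<delta> (a * b) = a * \<delta> b + \<delta> a * b - (\<delta> a * \<delta> b + G (\<delta> a * \<delta> b))"
    if a: "a \<in> A" and b: "b \<in> A" for a b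
  proof -
    have ab: "a * b = G a * b + (\<delta> a * G b + \<delta> a * \<delta> b)"
      by (simp add: \<delta>_def algebra_simps)
    have G\<delta>: "G (\<delta> a) = 0" using a by (simp add: \<delta>_def intermediate_diff[OF G] GD)
    have "G (a * b) = G (G a * b) + (G (\<delta> a * G b) + G (\<delta> a * \<delta> b))"
      unfolding ab using a b \<delta>A by (simp add: GD(5,7) A_closed)
    also have "\<dots> = G a * G b + G (\<delta> a * \<delta> b)"
      using a b \<delta>A by (simp add: intermediate_module[OF G] GD(4) G\<delta>)
    finally have "\<delta> (a * b) = a * b - (G a * G b + G (\<delta> a * \<delta> b))" by (simp add: \<delta>_def)
    thus ?thesis by (simp add: \<delta>_def algebra_simps)
  qed
  fix c assume c: "c \<in> C"
  hence cA: "c \<in> A" by (rule FD(3))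
  let ?r = "\<lambda>j. \<delta> c * \<delta> (\<mu> j) + G (\<delta> c * \<delta> (\<mu> j))"
  \<comment> \<open>First evaluation: expand \<open>c * \<mu> j\<close> in \<open>\<mu>\<close> and
    pull the coefficients out of \<open>\<delta>\<close>.\<close>
  have "(\<Sum>j<n. \<delta> (c * \<mu> j) * star (\<mu> j))
      = (\<Sum>j<n. \<Sum>k<n. \<delta> (\<mu> k) * (E (star (\<mu> k) * c * \<mu> j) * star (\<mu> j)))"
  proof (intro sum.cong refl)
    fix j assume j: "j \<in> {..<n}"
    have cj: "c * \<mu> j \<in> C" using c j by (simp add: C_closed \<mu>C)
    have b: "E (star (\<mu> k) * c * \<mu> j) \<in> B" if "k < n" for k
      using that j cA by (simp add: E_B A_closed \<mu>A)
    have "c * \<mu> j = (\<Sum>k<n. \<mu> k * E (star (\<mu> k) * c * \<mu> j))"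
      using exp_right[OF cj] by (simp add: mult.assoc)
    hence "c * \<mu> j - G (c * \<mu> j) = (\<Sum>k<n. \<mu> k * E (star (\<mu> k) * c * \<mu> j))
        - G (\<Sum>k<n. \<mu> k * E (star (\<mu> k) * c * \<mu> j))"
      by (rule arg_cong)
    also have "G (\<Sum>k<n. \<mu> k * E (star (\<mu> k) * c * \<mu> j))
        = (\<Sum>k<n. G (\<mu> k * E (star (\<mu> k) * c * \<mu> j)))"
      using b B_A \<mu>A by (intro bimod_sum bG) (auto intro!: A_closed(4))
    also have "\<dots> = (\<Sum>k<n. G (\<mu> k) * E (star (\<mu> k) * c * \<mu> j))"
      using b \<mu>A by (intro sum.cong refl bimodD(4)[OF bG]) auto
    finally have "\<delta> (c * \<mu> j) = (\<Sum>k<n. \<delta> (\<mu> k) * E (star (\<mu> k) * c * \<mu> j))"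
      by (simp add: \<delta>_def left_diff_distrib sum_subtractf)
    thus "\<delta> (c * \<mu> j) * star (\<mu> j)
        = (\<Sum>k<n. \<delta> (\<mu> k) * (E (star (\<mu> k) * c * \<mu> j) * star (\<mu> j)))"
      by (simp add: sum_distrib_right mult.assoc)
  qed
  also have "\<dots> = (\<Sum>k<n. \<delta> (\<mu> k) * (\<Sum>j<n. E (star (\<mu> k) * c * \<mu> j) * star (\<mu> j)))"
    by (subst sum.swap) (simp add: sum_distrib_left)
  also have "\<dots> = (\<Sum>k<n. \<delta> (\<mu> k) * (star (\<mu> k) * c))"
    using c by (intro sum.cong refl) (simp add: exp_left C_closed \<mu>C)
  also have "\<dots> = \<eta> *\<^sub>C c"
    by (simp add: mult.assoc[symmetric] sum_distrib_right[symmetric] \<eta> scaleC_mult_left)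
  finally have lhs: "(\<Sum>j<n. \<delta> (c * \<mu> j) * star (\<mu> j)) = \<eta> *\<^sub>C c" .
  \<comment> \<open>Second evaluation, by the approximate Leibniz rule. Since \<open>\<eta>\<close>
    is a scalar, its term \<open>c * (\<eta> *\<^sub>C 1)\<close> cancels the first result.\<close>
  have "(\<Sum>j<n. \<delta> (c * \<mu> j) * star (\<mu> j))
      = (\<Sum>j<n. c * (\<delta> (\<mu> j) * star (\<mu> j)) + \<delta> c * (\<mu> j * star (\<mu> j)) - ?r j * star (\<mu> j))"
    using cA \<mu>A by (intro sum.cong refl) (simp add: leibniz algebra_simps)
  also have "\<dots> = c * (\<eta> *\<^sub>C 1) + \<delta> c * (\<kappa> *\<^sub>C 1) - (\<Sum>j<n. ?r j * star (\<mu> j))"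
    unfolding \<eta>[symmetric] \<kappa>[symmetric]
    by (simp only: sum_subtractf sum.distrib sum_distrib_left)
  finally have "\<kappa> *\<^sub>C \<delta> c = (\<Sum>j<n. ?r j * star (\<mu> j))"
    unfolding lhs by (simp add: scaleC_mult_right)
  hence "cmod \<kappa> * norm (\<delta> c) = norm (\<Sum>j<n. ?r j * star (\<mu> j))"
    by (metis norm_scaleC)
  also have "\<dots> \<le> (\<Sum>j<n. 4 * e * norm (\<delta> c) * norm (l j))"
  proof (rule sum_norm_le)
    fix j assume j: "j \<in> {..<n}"
    have "norm (\<delta> c * \<delta> (\<mu> j)) \<le> norm (\<delta> c) * norm (\<delta> (\<mu> j))" by (rule norm_mult_ineq)
    also have "\<dots> \<le> norm (\<delta> c) * (2 * e)" using j \<delta>\<mu> by (intro mult_left_mono) auto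
    finally have 1: "norm (\<delta> c * \<delta> (\<mu> j)) \<le> 2 * e * norm (\<delta> c)" by (simp add: mult_ac)
    have "norm (G (\<delta> c * \<delta> (\<mu> j))) \<le> norm (\<delta> c * \<delta> (\<mu> j))"
      using j cA by (intro GD(8) A_closed \<delta>A \<mu>A) auto
    hence 2: "norm (?r j) \<le> 4 * e * norm (\<delta> c)"
      using 1 norm_triangle_ineq[of "\<delta> c * \<delta> (\<mu> j)" "G (\<delta> c * \<delta> (\<mu> j))"] by linarith
    have "norm (?r j * star (\<mu> j)) \<le> norm (?r j) * norm (\<mu> j)"
      using norm_mult_ineq[of "?r j" "star (\<mu> j)"] by simp
    also have "\<dots> \<le> 4 * e * norm (\<delta> c) * norm (l j)"
      using 2 \<mu>_norm[of j] j order_trans[OF norm_ge_zero 2] by (intro mult_mono) simp_all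
    finally show "norm (?r j * star (\<mu> j)) \<le> 4 * e * norm (\<delta> c) * norm (l j)" .
  qed
  also have "\<dots> = 4 * e * norm (\<delta> c) * L" by (simp add: L_def sum_distrib_left)
  finally have "L\<^sup>2 * (cmod \<kappa> * norm (\<delta> c)) \<le> L\<^sup>2 * (4 * e * norm (\<delta> c) * L)"
    by (intro mult_left_mono) auto
  hence "(L\<^sup>2 * cmod \<kappa>) * norm (\<delta> c) \<le> 4 * e * L ^ 3 * norm (\<delta> c)"
    by (simp add: power2_eq_square power3_eq_cube mult_ac)
  moreover have "1 * norm (\<delta> c) \<le> (L\<^sup>2 * cmod \<kappa>) * norm (\<delta> c)"
    using \<kappa>_ge by (rule mult_right_mono) simp
  ultimately have "(1 - 4 * e * L ^ 3) * norm (\<delta> c) \<le> 0" by (simp add: left_diff_distrib)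
  hence "norm (\<delta> c) = 0" using e by (simp add: mult_le_0_iff)
  hence "c = G c" by (simp add: \<delta>_def)
  thus "c \<in> D" using GD(4)[OF cA] by simp
qed

theorem finite_IMS: "finite (IMS B A E)"
proof (rule ccontr)
  assume inf: "infinite (IMS B A E)"
  \<comment> \<open>With \<open>e = 1 / K\<close> the product \<open>4 * e * L ^ 3\<close> is below
    1; adding 1 to \<open>L ^ 3\<close> keeps \<open>K\<close> positive when
    \<open>L = 0\<close>.\<close>
  define K where "K = 8 * (L ^ 3 + 1)"
  define e where "e = 1 / K"
  have "L ^ 3 \<ge> 0" using L_nonneg by (rule zero_le_power)
  hence "K > 0" unfolding K_def by (intro mult_pos_pos add_nonneg_pos) auto
  hence e: "e > 0" and "e * K = 1" by (simp_all add: e_def)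
  hence e1: "4 * e * L ^ 3 < 1" by (simp add: K_def algebra_simps)
  obtain C F D G where CD: "C \<noteq> D" "intermediate C F" "intermediate D G"
    and close: "\<And>k. k < n \<Longrightarrow> norm (F (l k) - G (l k)) \<le> e"
    by (rule intermediate_close_pair[OF inf e]) blast
  have "C \<subseteq> D" by (rule intermediate_subset_if_close[OF CD(2,3) close e1])
  moreover have "D \<subseteq> C"
    by (rule intermediate_subset_if_close[OF CD(3,2) _ e1]) (use close in \<open>simp add: norm_minus_commute\<close>)
  ultimately show False using CD(1) by blast
qed

end

section \<open>The tower\<close>

lemma finite_IMS_irreducible:
  assumes "irreducible_inclusion B A" "conditional_expectation A B E" "finite_index A E"
  shows "finite (IMS B A E)"
proof -
  obtain n l where "quasi_basis A E n l" using assms(3) by (auto simp: finite_index_def)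
  then interpret irreducible_finite_index A B E n l using assms by unfold_locales
  show ?thesis by (rule finite_IMS)
qed

text \<open>An \<open>x\<close> that commutes with \<open>A\<close> acts on the module
  \<open>A\<close> as right multiplication by \<open>z = p x 1\<close>. Adjointability forces
  \<open>z\<close> to commute with \<open>B\<close>, so \<open>z\<close> is a scalar, and
  injectivity of \<open>p\<close> identifies \<open>x\<close>. The property of \<open>E\<close> that
  is assumed is the one carried along the tower.\<close>

lemma irreducible_basic_construction:
  assumes irr: "irreducible_inclusion B A"
    and E: "\<And>b x. b \<in> B \<Longrightarrow> x \<in> A \<Longrightarrow> E (b * x) = b * E x"
    and fin: "finite_index A E"
    and bc: "basic_construction A E A1 e"
  shows "irreducible_inclusion A A1"
proof -
  have A: "cstar_subalgebra A" and B: "cstar_subalgebra B" and one: "1 \<in> B" "1 \<in> A" and BA: "B \<subseteq> A"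
    and comm: "relative_commutant B A = range (\<lambda>c. c *\<^sub>C 1)"
    using irr by (auto simp: irreducible_inclusion_def unital_inclusion_def)
  obtain n l where qb: "quasi_basis A E n l" using fin by (auto simp: finite_index_def)
  obtain p where inc: "unital_inclusion A A1" and p: "bij_betw p A1 (adjointable_maps A E)"
    and p_scale: "\<And>c x. x \<in> A1 \<Longrightarrow> p (c *\<^sub>C x) = (\<lambda>a\<in>A. c *\<^sub>C p x a)"
    and p_mult: "\<And>x y. x \<in> A1 \<Longrightarrow> y \<in> A1 \<Longrightarrow> p (x * y) = compose A (p x) (p y)"
    and p_left: "\<And>x. x \<in> A \<Longrightarrow> p x = (\<lambda>a\<in>A. x * a)"
    using bc unfolding basic_construction_def by metis
  have A1: "cstar_subalgebra A1" "A \<subseteq> A1" using inc by (auto simp: unital_inclusion_def)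
  have "\<exists>c. x = c *\<^sub>C 1" if x: "x \<in> A1" and xA: "\<And>a. a \<in> A \<Longrightarrow> a * x = x * a" for x
  proof -
    define z where "z = p x 1"
    have "p x \<in> adjointable_maps A E" using p x by (auto simp: bij_betw_def)
    then obtain s where t: "p x \<in> A \<rightarrow>\<^sub>E A" and s: "s \<in> A \<rightarrow>\<^sub>E A" and ad: "module_adjoint A E (p x) s"
      by (auto simp: adjointable_maps_def)
    have z: "z \<in> A" using t one by (auto simp: z_def)
    have right_mult: "p x a = a * z" if a: "a \<in> A" for a
    proof -
      have "p x a = p (x * a) 1"
        using a x A1 one by (subst p_mult) (auto simp: compose_def p_left)
      also have "\<dots> = p (a * x) 1" using xA[OF a] by simp
      also have "\<dots> = a * z"
        using a x A1 one t by (subst p_mult) (auto simp: compose_def p_left z_def)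
      finally show ?thesis .
    qed
    have "b * z = z * b" if b: "b \<in> B" for b
    proof -
      have bA: "b \<in> A" "star b \<in> B" "star b \<in> A"
        using b BA cstar_subalgebra_closed(5)[OF B] by auto
      \<comment> \<open>Here \<open>b * z\<close> is the value of \<open>p x\<close> at
        \<open>b\<close>. Passing to the adjoint \<open>s\<close> frees \<open>star b\<close>, which
        then leaves \<open>E\<close> by left linearity.\<close>
      have eq: "E (star (b * z) * y) = E (star (z * b) * y)" if y: "y \<in> A" for y
      proof -
        have sy: "s y \<in> A" using s y by auto
        have "E (star (b * z) * y) = E (star b * s y)"
          using ad bA(1) y by (simp add: module_adjoint_def flip: right_mult)
        also have "\<dots> = star b * E (s y)" using E[OF bA(2) sy] .
        also have "E (s y) = E (star z * y)"
          using ad one(2) y unfolding module_adjoint_def by (metis mult_1 star_one z_def)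
        also have "star b * \<dots> = E (star b * (star z * y))"
          using bA(2) z y A by (simp add: E cstar_subalgebra_closed)
        finally show ?thesis by (simp add: star_mult mult.assoc)
      qed
      have "b * z \<in> A" "z * b \<in> A" using bA z A by (auto intro: cstar_subalgebra_closed)
      hence "star (b * z) \<in> A" "star (z * b) \<in> A" using A by (auto intro: cstar_subalgebra_closed)
      \<comment> \<open>The quasi-basis recovers an element from its pairings, so \<open>E\<close>
        separates \<open>star (b * z)\<close> from \<open>star (z * b)\<close> if they
        differ.\<close>
      moreover have exp: "u = (\<Sum>i<n. E (u * l i) * star (l i))" if "u \<in> A" for u
        using qb that unfolding quasi_basis_def by blast
      moreover have "(\<Sum>i<n. E (star (b * z) * l i) * star (l i))
          = (\<Sum>i<n. E (star (z * b) * l i) * star (l i))"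
        using qb by (intro sum.cong refl) (simp add: eq quasi_basis_def)
      ultimately have "star (b * z) = star (z * b)" by metis
      thus ?thesis by (metis star_star)
    qed
    hence "z \<in> relative_commutant B A" using z by (simp add: relative_commutant_def)
    then obtain c where c: "z = c *\<^sub>C 1" using comm by auto
    have 1: "1 \<in> A1" "c *\<^sub>C 1 \<in> A1" using one A1 cstar_subalgebra_closed(3)[OF A1(1)] by auto
    have "p x = p (c *\<^sub>C 1)"
    proof (rule extensionalityI[of _ A])
      show "p x \<in> extensional A" using t by (auto simp: PiE_def)
      show "p (c *\<^sub>C 1) \<in> extensional A" by (simp add: p_scale[OF 1(1)])
      show "p x a = p (c *\<^sub>C 1) a" if "a \<in> A" for a
        using that one(2) by (simp add: right_mult p_scale[OF 1(1)] p_left c scaleC_mult_right)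
    qed
    hence "x = c *\<^sub>C 1" using p x 1(2) by (meson bij_betw_def inj_onD)
    thus ?thesis by blast
  qed
  moreover have "c *\<^sub>C 1 \<in> A1" for c
    using one A1 cstar_subalgebra_closed(3)[OF A1(1)] by auto
  moreover have "a * (c *\<^sub>C 1) = (c *\<^sub>C 1) * a" for a :: 'a and c
    by (simp add: scaleC_mult_left scaleC_mult_right)
  ultimately have "relative_commutant A A1 = range (\<lambda>c. c *\<^sub>C 1)"
    unfolding relative_commutant_def by blast
  thus ?thesis using inc by (simp add: irreducible_inclusion_def)
qed

section \<open>Transport along star-isomorphisms\<close>

lemma irreducible_inclusion_iso:
  assumes irr: "irreducible_inclusion B A"
    and f: "star_isomorphism A A' f" and B': "f ` B = B'" and inc: "unital_inclusion B' A'"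
  shows "irreducible_inclusion B' A'"
proof -
  have A: "1 \<in> A" "B \<subseteq> A" "cstar_subalgebra A" and comm: "relative_commutant B A = range (\<lambda>c. c *\<^sub>C 1)"
    using irr by (auto simp: irreducible_inclusion_def unital_inclusion_def)
  have bij: "bij_betw f A A'" and fm: "\<And>x y. x \<in> A \<Longrightarrow> y \<in> A \<Longrightarrow> f (x * y) = f x * f y"
    and fs: "\<And>c x. x \<in> A \<Longrightarrow> f (c *\<^sub>C x) = c *\<^sub>C f x"
    using f by (auto simp: star_isomorphism_def)
  have A': "cstar_subalgebra A'" "1 \<in> A'" using inc by (auto simp: unital_inclusion_def)
  \<comment> \<open>A star-isomorphism is not unital by definition; here this follows by
    surjectivity, as \<open>f 1\<close> is a left unit for \<open>f u = 1\<close>.\<close>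
  then obtain u where u: "u \<in> A" "1 = f u" using bij by (auto simp: bij_betw_def)
  have "f 1 * f u = f u" using fm[of 1 u] A(1) u by simp
  hence f1: "f 1 = 1" by (simp flip: u(2))
  have "relative_commutant B' A' \<subseteq> range (\<lambda>c. c *\<^sub>C 1)"
  proof
    fix y assume y: "y \<in> relative_commutant B' A'"
    then obtain x where x: "x \<in> A" "y = f x"
      using bij by (auto simp: relative_commutant_def bij_betw_def)
    have "b * x = x * b" if b: "b \<in> B" for b
    proof -
      have bA: "b \<in> A" using b A by auto
      have "f b * y = y * f b" using y b B' by (auto simp: relative_commutant_def)
      hence "f (b * x) = f (x * b)" using x bA by (simp add: fm)
      moreover have "b * x \<in> A" "x * b \<in> A" using x bA A(3) by (auto intro: cstar_subalgebra_closed)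
      ultimately show ?thesis using bij by (meson bij_betw_def inj_onD)
    qed
    hence "x \<in> relative_commutant B A" using x by (simp add: relative_commutant_def)
    then obtain c where "x = c *\<^sub>C 1" using comm by auto
    thus "y \<in> range (\<lambda>c. c *\<^sub>C 1)" using x A f1 by (simp add: fs)
  qed
  moreover have "range (\<lambda>c. c *\<^sub>C 1) \<subseteq> relative_commutant B' A'"
    using A' by (auto simp: relative_commutant_def scaleC_mult_left scaleC_mult_right
        intro: cstar_subalgebra_closed)
  ultimately show ?thesis using inc by (simp add: irreducible_inclusion_def)
qed

lemma finite_index_iso:
  assumes A: "cstar_subalgebra A" and EA: "\<And>x. x \<in> A \<Longrightarrow> E x \<in> A" and fin: "finite_index A E"
    and f: "star_isomorphism A A' f" and E': "\<And>x. x \<in> A \<Longrightarrow> E' (f x) = f (E x)"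
  shows "finite_index A' E'"
proof -
  obtain n l where qb: "quasi_basis A E n l" using fin by (auto simp: finite_index_def)
  note cl = cstar_subalgebra_closed[OF A]
  have l: "l i \<in> A" if "i < n" for i using qb that unfolding quasi_basis_def by blast
  have bij: "bij_betw f A A'" and fm: "\<And>x y. x \<in> A \<Longrightarrow> y \<in> A \<Longrightarrow> f (x * y) = f x * f y"
    and fa: "\<And>x y. x \<in> A \<Longrightarrow> y \<in> A \<Longrightarrow> f (x + y) = f x + f y"
    and fstar: "\<And>x. x \<in> A \<Longrightarrow> f (star x) = star (f x)"
    using f by (auto simp: star_isomorphism_def)
  have f0: "f 0 = 0" using fa[of 0 0] cl(1) by simp
  have fsum: "f (sum g I) = (\<Sum>i\<in>I. f (g i))" if "\<And>i. i \<in> I \<Longrightarrow> g i \<in> A" for g :: "nat \<Rightarrow> 'a" and I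
    using that by (induction I rule: infinite_finite_induct)
      (auto simp: f0 fa cstar_subalgebra_sum[OF A])
  have "quasi_basis A' E' n (\<lambda>i. f (l i))"
    unfolding quasi_basis_def
  proof (intro conjI ballI allI impI)
    show "f (l i) \<in> A'" if "i < n" for i using bij l[OF that] by (auto simp: bij_betw_def)
    fix y assume "y \<in> A'"
    then obtain x where x: "x \<in> A" "y = f x" using bij by (auto simp: bij_betw_def)
    have "x = (\<Sum>i<n. E (x * l i) * star (l i))" using qb x(1) unfolding quasi_basis_def by blast
    hence "y = f (\<Sum>i<n. E (x * l i) * star (l i))" using x(2) by simp
    also have "\<dots> = (\<Sum>i<n. f (E (x * l i) * star (l i)))"
      using x(1) l by (intro fsum) (auto intro!: cl EA)
    also have "\<dots> = (\<Sum>i<n. E' (y * f (l i)) * star (f (l i)))"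
    proof (intro sum.cong refl)
      fix i assume i: "i \<in> {..<n}"
      hence "E' (y * f (l i)) = f (E (x * l i))"
        using x l by (simp add: E' cl flip: fm)
      thus "f (E (x * l i) * star (l i)) = E' (y * f (l i)) * star (f (l i))"
        using i x(1) l by (simp add: fm EA cl fstar)
    qed
    finally show "y = (\<Sum>i<n. E' (y * f (l i)) * star (f (l i)))" .
  qed
  thus ?thesis by (auto simp: finite_index_def)
qed

section \<open>Induction along the tower\<close>

lemma conditional_expectation_left_module:
  assumes "conditional_expectation A B E" "1 \<in> B" "b \<in> B" "x \<in> A"
  shows "E (b * x) = b * E x"
proof -
  have "E (b * x * 1) = b * E x * 1"
    using assms unfolding conditional_expectation_def by blast
  thus ?thesis by simp
qed

text \<open>The invariant is what \<open>irreducible_basic_construction\<close> consumes. At the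
  base it is transported from \<open>B\<close> and \<open>A\<close> along \<open>f\<close>; at each
  later level finite index and left linearity come from the dual expectation. The index is shifted
  so that \<open>k = 0\<close> is the inclusion of \<open>T (- 1)\<close> in
  \<open>T 0\<close>.\<close>

lemma irreducible_tower:
  assumes irr: "irreducible_inclusion B A" and ce: "conditional_expectation A B E"
    and fin: "finite_index A E" and tower: "basic_construction_tower B A E f T F"
  shows "irreducible_inclusion (T (int k - 1)) (T (int k)) \<and> finite_index (T (int k)) (F (int k)) \<and>
    (\<forall>b\<in>T (int k - 1). \<forall>x\<in>T (int k). F (int k) (b * x) = b * F (int k) x)"
proof (induction k)
  case 0
  have A: "cstar_subalgebra A" "1 \<in> B" "B \<subseteq> A"
    using irr by (auto simp: irreducible_inclusion_def unital_inclusion_def)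
  have inc: "unital_inclusion (T (- 1)) (T 0)" and f: "star_isomorphism A (T 0) f"
    and fB: "f ` B = T (- 1)" and F0: "\<And>x. x \<in> A \<Longrightarrow> F 0 (f x) = f (E x)"
    using tower by (auto simp: basic_construction_tower_def)
  have EA: "E x \<in> A" if "x \<in> A" for x
    using ce A that by (auto simp: conditional_expectation_def)
  have fm: "f (x * y) = f x * f y" if "x \<in> A" "y \<in> A" for x y
    using f that by (auto simp: star_isomorphism_def)
  have "F 0 (b' * x') = b' * F 0 x'" if b': "b' \<in> T (- 1)" and x': "x' \<in> T 0" for b' x'
  proof -
    obtain b where b: "b \<in> B" "b' = f b" using b' fB by auto
    obtain x where x: "x \<in> A" "x' = f x"
      using x' f unfolding star_isomorphism_def bij_betw_def by blast
    have bA: "b \<in> A" using b A by auto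
    have "F 0 (b' * x') = F 0 (f (b * x))" using b x bA by (simp add: fm)
    also have "\<dots> = f (b * E x)"
      using bA x b(1) A ce by (simp add: F0 cstar_subalgebra_closed conditional_expectation_left_module)
    also have "\<dots> = b' * F 0 x'" using bA x b EA by (simp add: fm F0)
    finally show ?thesis .
  qed
  thus ?case
    using irreducible_inclusion_iso[OF irr f fB inc] finite_index_iso[OF A(1) EA fin f F0] by simp
next
  case (Suc k)
  obtain e where bc: "basic_construction (T (int k)) (F (int k)) (T (int k + 1)) e"
    and dual: "dual_expectation (T (int k)) (F (int k)) (T (int k + 1)) e (F (int k + 1))"
    using tower unfolding basic_construction_tower_def by (meson of_nat_0_le_iff)
  have irr': "irreducible_inclusion (T (int k)) (T (int k + 1))"
    by (rule irreducible_basic_construction[OF _ _ _ bc]) (use Suc in blast)+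
  hence "1 \<in> T (int k)" by (simp add: irreducible_inclusion_def unital_inclusion_def)
  hence "\<forall>b\<in>T (int k). \<forall>x\<in>T (int k + 1). F (int k + 1) (b * x) = b * F (int k + 1) x"
    using dual conditional_expectation_left_module unfolding dual_expectation_def by blast
  thus ?case using irr' dual by (simp add: dual_expectation_def add.commute)
qed

theorem corollary4p2:
  fixes A B :: "'a::unital_cstar_algebra set" and E :: "'a \<Rightarrow> 'a"
  assumes "irreducible_inclusion B A"
    and "conditional_expectation A B E"
    and "finite_index A E"
  shows "finite (IMS B A E) \<and>
    (\<forall>(f :: 'a \<Rightarrow> 'b::unital_cstar_algebra) T F.
       basic_construction_tower B A E f T F \<longrightarrow>
       (\<forall>k\<ge>0. finite (IMS (T k) (T (k + 1)) (F (k + 1)))))"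
proof (intro conjI allI impI)
  show "finite (IMS B A E)" using assms by (rule finite_IMS_irreducible)
  fix f :: "'a \<Rightarrow> 'b" and T F k
  assume tower: "basic_construction_tower B A E f T F" and "0 \<le> (k::int)"
  then obtain j where k: "k = int j" by (metis nonneg_int_cases)
  have "irreducible_inclusion (T k) (T (k + 1)) \<and> finite_index (T (k + 1)) (F (k + 1))"
    \<comment> \<open>The inclusion of \<open>T k\<close> in \<open>T (k + 1)\<close> is stage
      \<open>Suc j\<close> of the induction.\<close>
    using irreducible_tower[OF assms tower, of "Suc j"] by (simp add: k add.commute)
  moreover have "conditional_expectation (T (k + 1)) (T k) (F (k + 1))"
    using tower \<open>0 \<le> k\<close> by (auto simp: basic_construction_tower_def dual_expectation_def)
  ultimately show "finite (IMS (T k) (T (k + 1)) (F (k + 1)))"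
    by (blast intro: finite_IMS_irreducible)
qed

end
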